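(* Let $k\ge3$ and let $\tau\in\{12,\,21,\,1\mbox{-}2\}$, so that $\tau\mbox{-}3\mbox{-}\cdots\mbox{-}k$ is one of the generalized patterns $12\mbox{-}3\mbox{-}\cdots\mbox{-}k$, $21\mbox{-}3\mbox{-}\cdots\mbox{-}k$, $1\mbox{-}2\mbox{-}3\mbox{-}\cdots\mbox{-}k$. For $n\ge0$ let $ud(n)$ and $uu(n)$ be the numbers of up-down, respectively up-up, permutations of length $n$ that avoid $1\mbox{-}3\mbox{-}2$ and contain $\tau\mbox{-}3\mbox{-}\cdots\mbox{-}k$ exactly once. Then (1) $\sum_{n\ge0}ud(n)x^n=\dfrac{x}{U_{k-1}^2\left(\frac1{2x}\right)}$; (2) $\sum_{n\ge0}uu(n)x^n=\dfrac{1}{U_{k-1}^2\left(\frac1{2x}\right)}$; (3) there is no up-down permutation and no up-up permutation that avoids $1\mbox{-}3\mbox{-}2$ and contains the classical pattern $2\mbox{-}1\mbox{-}3\mbox{-}\cdots\mbox{-}k$ exactly once (i.e. the corresponding generating functions are $0$).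
   Context: A permutation of length $n$ is a word $\pi_1\cdots\pi_n$ containing each of $1,\dots,n$ exactly once. Generalized patterns: a pattern is a permutation $\tau_1\cdots\tau_m$ written with some dashes between consecutive letters; an occurrence in $\pi$ is a tuple of indices $i_1<\dots<i_m$ such that $\pi_{i_1}\cdots\pi_{i_m}$ is order-isomorphic to $\tau_1\cdots\tau_m$ and such that $i_{j+1}=i_j+1$ whenever there is no dash between $\tau_j$ and $\tau_{j+1}$. Thus $1\mbox{-}3\mbox{-}2$ and $1\mbox{-}2\mbox{-}\cdots\mbox{-}k$, $2\mbox{-}1\mbox{-}3\mbox{-}\cdots\mbox{-}k$ are classical patterns (arbitrary subsequences), while in $12\mbox{-}3\mbox{-}\cdots\mbox{-}k$ and $21\mbox{-}3\mbox{-}\cdots\mbox{-}k$ the first two letters must occupy adjacent positions. $\pi$ contains a pattern exactly $r$ times if it has exactly $r$ occurrences, and avoids it if $r=0$. For $n\ge2$: up-down permutations satisfy $\pi_1<\pi_2>\pi_3<\cdots$ with $n$ odd; up-up ones satisfy $\pi_1<\pi_2>\pi_3<\cdots$ with $n$ even; for $n=0,1$ there are none. $U_r$ is the Chebyshev polynomial of the second kind, $U_r(\cos\theta)=\sin((r+1)\theta)/\sin\theta$. *)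

theory Defs
  imports
    Complex_Main
    "HOL-Computational_Algebra.Formal_Laurent_Series"
    "HOL-Computational_Algebra.Polynomial"
    "HOL-Combinatorics.Multiset_Permutations"
begin

text \<open>
  A generalized pattern is the list of its maximal dash-free blocks: \<open>12-3-4\<close> is
  \<open>[[1,2],[3],[4]]\<close> and \<open>1-3-2\<close> is \<open>[[1],[3],[2]]\<close>.
\<close>
type_synonym gpattern = "nat list list"

text \<open>\<open>j \<in> dashes p\<close> means that there is a dash directly after the first \<open>j\<close> letters.\<close>
definition dashes :: "gpattern \<Rightarrow> nat set" where
  "dashes p = {length (concat (take m p)) | m. 0 < m \<and> m < length p}"

text \<open>Positions, in words as well as in patterns, are counted from \<open>0\<close>.\<close>
definition occurrences :: "gpattern \<Rightarrow> nat list \<Rightarrow> nat list set" where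
  "occurrences p \<pi> =
    (let t = concat p; m = length t in
     {is. length is = m \<and> sorted_wrt (<) is \<and> (\<forall>i\<in>set is. i < length \<pi>) \<and>
        (\<forall>a<m. \<forall>b<m. \<pi> ! (is ! a) < \<pi> ! (is ! b) \<longleftrightarrow> t ! a < t ! b) \<and>
        (\<forall>j. Suc j < m \<and> Suc j \<notin> dashes p \<longrightarrow> is ! Suc j = Suc (is ! j))})"

definition contains_exactly :: "nat \<Rightarrow> gpattern \<Rightarrow> nat list \<Rightarrow> bool" where
  "contains_exactly r p \<pi> \<longleftrightarrow> card (occurrences p \<pi>) = r"

definition avoids :: "gpattern \<Rightarrow> nat list \<Rightarrow> bool" where
  "avoids p \<pi> \<longleftrightarrow> contains_exactly 0 p \<pi>"

definition up_alternating :: "nat list \<Rightarrow> bool" where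
  "up_alternating \<pi> \<longleftrightarrow>
    (\<forall>i. Suc i < length \<pi> \<longrightarrow>
       (if even i then \<pi> ! i < \<pi> ! Suc i else \<pi> ! i > \<pi> ! Suc i))"

definition up_down_perms :: "nat \<Rightarrow> nat list set" where
  "up_down_perms n = {\<pi> \<in> permutations_of_set {1..n}. n \<ge> 2 \<and> odd n \<and> up_alternating \<pi>}"

definition up_up_perms :: "nat \<Rightarrow> nat list set" where
  "up_up_perms n = {\<pi> \<in> permutations_of_set {1..n}. n \<ge> 2 \<and> even n \<and> up_alternating \<pi>}"

text \<open>The pattern written \<open>\<tau>-3-\<dots>-k\<close>.\<close>
definition extend_pattern :: "gpattern \<Rightarrow> nat \<Rightarrow> gpattern" where
  "extend_pattern \<tau> k = \<tau> @ map (\<lambda>i. [i]) [3..<Suc k]"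

definition ud :: "gpattern \<Rightarrow> nat \<Rightarrow> nat" where
  "ud p n = card {\<pi> \<in> up_down_perms n. avoids [[1],[3],[2]] \<pi> \<and> contains_exactly 1 p \<pi>}"

definition uu :: "gpattern \<Rightarrow> nat \<Rightarrow> nat" where
  "uu p n = card {\<pi> \<in> up_up_perms n. avoids [[1],[3],[2]] \<pi> \<and> contains_exactly 1 p \<pi>}"

definition chebyshev_U :: "nat \<Rightarrow> real poly" where
  "chebyshev_U r = (THE p. \<forall>\<theta>. sin \<theta> \<noteq> 0 \<longrightarrow>
      poly p (cos \<theta>) = sin (real (r + 1) * \<theta>) / sin \<theta>)"

lemma chebyshev_U_unique:
  fixes p q :: "real poly"
  assumes "\<forall>\<theta>. sin \<theta> \<noteq> 0 \<longrightarrow> poly p (cos \<theta>) = f \<theta>"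
    and "\<forall>\<theta>. sin \<theta> \<noteq> 0 \<longrightarrow> poly q (cos \<theta>) = f \<theta>"
  shows "p = q"
proof (rule ccontr)
  assume "p \<noteq> q"
  then have fin: "finite {x. poly (p - q) x = 0}"
    by (intro poly_roots_finite) simp
  have "{-1<..<1} \<subseteq> {x. poly (p - q) x = 0}"
  proof
    fix x :: real
    assume x: "x \<in> {-1<..<1}"
    then have "x\<^sup>2 < 1"
      by (simp add: abs_square_less_1 abs_if)
    then have "sin (arccos x) \<noteq> 0"
      using x by (simp add: sin_arccos)
    with assms have "poly p (cos (arccos x)) = poly q (cos (arccos x))"
      by simp
    with x show "x \<in> {x. poly (p - q) x = 0}"
      by simp
  qed
  with fin have "finite {-1<..<1::real}"
    by (rule rev_finite_subset)
  then show False
    using infinite_Ioo[of "-1::real" 1] by simp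
qed

fun chebyshev_U_rec :: "nat \<Rightarrow> real poly" where
  "chebyshev_U_rec 0 = 1"
| "chebyshev_U_rec (Suc 0) = [:0, 2:]"
| "chebyshev_U_rec (Suc (Suc r)) = [:0, 2:] * chebyshev_U_rec (Suc r) - chebyshev_U_rec r"

lemma chebyshev_U_rec_cos:
  "sin \<theta> \<noteq> 0 \<Longrightarrow> poly (chebyshev_U_rec r) (cos \<theta>) = sin (real (r + 1) * \<theta>) / sin \<theta>"
proof (induction r rule: chebyshev_U_rec.induct)
  case 2
  then show ?case by (simp add: sin_double)
next
  case (3 r)
  have "sin (real (r + 3) * \<theta>) + sin (real (r + 1) * \<theta>) = 2 * cos \<theta> * sin (real (r + 2) * \<theta>)"
    using sin_add[of "real (r + 2) * \<theta>" \<theta>] sin_diff[of "real (r + 2) * \<theta>" \<theta>]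
    by (simp add: algebra_simps)
  with 3 show ?case
    by (simp add: field_simps)
qed simp

lemma chebyshev_U_eq_rec: "chebyshev_U r = chebyshev_U_rec r"
  unfolding chebyshev_U_def
proof (rule the_equality)
  show *: "\<forall>\<theta>. sin \<theta> \<noteq> 0 \<longrightarrow>
      poly (chebyshev_U_rec r) (cos \<theta>) = sin (real (r + 1) * \<theta>) / sin \<theta>"
    using chebyshev_U_rec_cos by blast
  show "p = chebyshev_U_rec r"
    if "\<forall>\<theta>. sin \<theta> \<noteq> 0 \<longrightarrow> poly p (cos \<theta>) = sin (real (r + 1) * \<theta>) / sin \<theta>" for p
    using that * by (rule chebyshev_U_unique)
qed

lemma chebyshev_U_cos:
  "sin \<theta> \<noteq> 0 \<Longrightarrow> poly (chebyshev_U r) (cos \<theta>) = sin (real (r + 1) * \<theta>) / sin \<theta>"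
  unfolding chebyshev_U_eq_rec by (rule chebyshev_U_rec_cos)

text \<open>\<open>U\<^sub>r(1/(2x))\<close>, an element of the field of formal Laurent series in \<open>x\<close>.\<close>
definition chebyshev_U_inv2X :: "nat \<Rightarrow> real fls" where
  "chebyshev_U_inv2X r = poly (map_poly fls_const (chebyshev_U r)) (1 / (2 * fls_X))"

end

theory Submission
  imports Defs
begin

text \<open>
  An alternating \<open>132\<close>-avoiding permutation of length at least two factors uniquely around its
  maximum as \<open>L n R\<close> with \<open>|L|\<close> odd and every letter of \<open>L\<close> above every letter of \<open>R\<close>. For
  \<open>k \<ge> 3\<close> an occurrence of \<open>\<tau>-3-\<dots>-k\<close> cannot straddle \<open>L\<close> and \<open>R\<close>, so the number of occurrences
  satisfies \<open>N\<^sub>k(L n R) = N\<^sub>k(L) + N\<^sub>k(R) + N\<^sub>k\<^sub>-\<^sub>1(L)\<close>. On odd lengths \<open>N\<^sub>2\<close> vanishes exactly on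
  length \<open>1\<close> and equals \<open>1\<close> exactly on \<open>231\<close>, for all three choices of \<open>\<tau>\<close>, and \<open>N\<^sub>k > 0\<close> forces
  \<open>N\<^sub>k\<^sub>-\<^sub>1 \<ge> 2\<close>. Hence the series \<open>O\<^sub>k\<close> (avoiding, odd length) and \<open>G\<^sub>k\<close> (exactly once, odd length)
  satisfy \<open>O\<^sub>k = x + x O\<^sub>k\<^sub>-\<^sub>1 O\<^sub>k\<close> and \<open>G\<^sub>k = x G\<^sub>k\<^sub>-\<^sub>1 O\<^sub>k + x O\<^sub>k\<^sub>-\<^sub>1 G\<^sub>k\<close>, that is
  \<open>O\<^sub>k = U\<^sub>k\<^sub>-\<^sub>2 / U\<^sub>k\<^sub>-\<^sub>1\<close> and \<open>G\<^sub>k = G\<^sub>k\<^sub>-\<^sub>1 O\<^sub>k\<^sup>2\<close>; even lengths differ by a factor \<open>x\<close>. For \<open>2-1\<close>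
  the number of inversions of an odd-length word is never \<open>1\<close>, and the recursion preserves this.
\<close>

subsection \<open>Occurrences around a maximal letter\<close>

text \<open>The flag \<open>adj\<close> asks for the first two letters to be adjacent; all other dashes are present.\<close>
definition occ :: "bool \<Rightarrow> nat list \<Rightarrow> nat list \<Rightarrow> nat list set" where
  "occ adj t \<pi> = {is. length is = length t \<and> sorted_wrt (<) is \<and> (\<forall>i\<in>set is. i < length \<pi>) \<and>
     (\<forall>a<length t. \<forall>b<length t. \<pi> ! (is ! a) < \<pi> ! (is ! b) \<longleftrightarrow> t ! a < t ! b) \<and>
     (adj \<longrightarrow> is ! 1 = Suc (is ! 0))}"

lemma occD:
  assumes "is \<in> occ adj t \<pi>"
  shows "length is = length t" "sorted_wrt (<) is" "\<And>i. i \<in> set is \<Longrightarrow> i < length \<pi>"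
    "\<And>a b. a < length t \<Longrightarrow> b < length t \<Longrightarrow> \<pi> ! (is ! a) < \<pi> ! (is ! b) \<longleftrightarrow> t ! a < t ! b"
    "adj \<Longrightarrow> is ! 1 = Suc (is ! 0)"
  using assms by (auto simp: occ_def)

lemma occI:
  assumes "length is = length t" "sorted_wrt (<) is" "\<And>i. i \<in> set is \<Longrightarrow> i < length \<pi>"
    "\<And>a b. a < length t \<Longrightarrow> b < length t \<Longrightarrow> \<pi> ! (is ! a) < \<pi> ! (is ! b) \<longleftrightarrow> t ! a < t ! b"
    "adj \<Longrightarrow> is ! 1 = Suc (is ! 0)"
  shows "is \<in> occ adj t \<pi>"
  using assms by (auto simp: occ_def)

text \<open>Reduces the positions of dashes to arithmetic: after the blocks \<open>ps\<close>, each
  further block adds one letter.\<close>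

lemma length_concat_take_singletons:
  "length (concat (take m (ps @ map (\<lambda>i. [i]) xs))) =
     length (concat (take m ps)) + min (m - length ps) (length xs)"
proof -
  have "length (concat (map (\<lambda>i. [i]) ys)) = length ys" for ys :: "nat list"
    by (induction ys) auto
  then show ?thesis by (simp add: take_map min.commute)
qed

text \<open>Only the position between the first two letters can lack a dash, and it does exactly
  when \<tau> is a single block. The adjacency clause thus shrinks to the flag
  \<open>length \<tau> = 1\<close>.\<close>

lemma occurrences_extend_pattern:
  assumes "\<tau> = [[a, b]] \<or> \<tau> = [[a], [b]]" and "k \<ge> 2"
  shows "occurrences (extend_pattern \<tau> k) \<pi> = occ (length \<tau> = 1) (concat \<tau> @ [3..<Suc k]) \<pi>"
proof -
  have len: "length (concat \<tau>) = 2" using assms by auto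
  have con: "concat (extend_pattern \<tau> k) = concat \<tau> @ [3..<Suc k]"
    by (simp add: extend_pattern_def del: upt_Suc)
  have dash: "j \<in> dashes (extend_pattern \<tau> k) \<longleftrightarrow> (length \<tau> = 1 \<longrightarrow> j \<noteq> 1)" if j: "0 < j" "j < k" for j
  proof -
    have "j \<in> dashes (extend_pattern \<tau> k) \<longleftrightarrow> (\<exists>m>0. m < length \<tau> + (k - 2) \<and>
        j = length (concat (take m \<tau>)) + min (m - length \<tau>) (k - 2))"
      unfolding dashes_def extend_pattern_def length_concat_take_singletons using assms(2)
      by (auto simp del: upt_Suc)
    also have "\<dots> \<longleftrightarrow> (length \<tau> = 1 \<longrightarrow> j \<noteq> 1)"
    proof (cases "\<tau> = [[a, b]]")
      case True
      \<comment> \<open>The first block has two letters, so \<open>m\<close> blocks cover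
        \<open>Suc m\<close> letters and position 1 is the only one missed.\<close>
      have "(\<exists>m>0. m < length \<tau> + (k - 2) \<and>
          j = length (concat (take m \<tau>)) + min (m - length \<tau>) (k - 2)) \<longleftrightarrow>
        (\<exists>m>0. m < k - 1 \<and> j = Suc m)"
        using True assms(2) by (intro ex_cong) (auto simp: take_Cons')
      then show ?thesis using True j by (auto intro!: exI[of _ "j - 1"])
    next
      case False
      then have \<tau>: "\<tau> = [[a], [b]]" using assms by simp
      have "(\<exists>m>0. m < length \<tau> + (k - 2) \<and>
          j = length (concat (take m \<tau>)) + min (m - length \<tau>) (k - 2)) \<longleftrightarrow>
        (\<exists>m>0. m < k \<and> j = m)"
        using \<tau> assms(2) by (intro ex_cong) (auto simp: take_Cons')
      then show ?thesis using \<tau> j by auto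
    qed
    finally show ?thesis .
  qed
  have "(\<forall>j. Suc j < k \<and> Suc j \<notin> dashes (extend_pattern \<tau> k) \<longrightarrow> is ! Suc j = Suc (is ! j)) \<longleftrightarrow>
      (length \<tau> = 1 \<longrightarrow> is ! 1 = Suc (is ! 0))" for "is"
    using assms(2) dash by auto
  moreover have "length (concat \<tau> @ [3..<Suc k]) = k" using len assms(2) by (auto simp del: upt_Suc)
  ultimately show ?thesis
    unfolding occurrences_def occ_def con Let_def by simp
qed

lemma finite_occ: "finite (occ adj t \<pi>)"
  by (rule finite_subset[OF _ finite_lists_length_eq[of "{..<length \<pi>}" "length t"]])
    (auto simp: occ_def)

lemma occ_short:
  assumes "length \<pi> < length t"
  shows "occ adj t \<pi> = {}"
proof -
  have False if "is \<in> occ adj t \<pi>" for "is"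
  proof -
    have "distinct is" using occD(2)[OF that] by (simp add: strict_sorted_iff)
    then have "length is = card (set is)" by (simp add: distinct_card)
    also have "\<dots> \<le> card {..<length \<pi>}" using occD(3)[OF that] by (intro card_mono) auto
    finally show False using occD(1)[OF that] assms by simp
  qed
  then show ?thesis by auto
qed

lemma occ_map_add: "occ adj t (map ((+) c) \<pi>) = occ adj t \<pi>"
proof -
  have "(\<forall>a<length t. \<forall>b<length t. map ((+) c) \<pi> ! (is ! a) < map ((+) c) \<pi> ! (is ! b) \<longleftrightarrow> t ! a < t ! b)
     \<longleftrightarrow> (\<forall>a<length t. \<forall>b<length t. \<pi> ! (is ! a) < \<pi> ! (is ! b) \<longleftrightarrow> t ! a < t ! b)"
    if "length is = length t" "\<forall>i\<in>set is. i < length \<pi>" for "is"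
    using that by auto
  then show ?thesis unfolding occ_def by auto
qed

text \<open>Cases on where the last letter of the pattern, its maximum, is placed: before, at or
  after \<open>N\<close>. The bound \<open>length t \<ge> 2\<close> keeps both letters constrained
  by \<open>adj\<close> inside \<open>t\<close> when the last letter is removed.\<close>

lemma occ_append_max:
  assumes t: "length t \<ge> 2" "\<And>y. y \<in> set t \<Longrightarrow> y < m"
    and LR: "\<And>x y. x \<in> set L \<Longrightarrow> y \<in> set R \<Longrightarrow> y < x"
    and N: "\<And>x. x \<in> set L \<union> set R \<Longrightarrow> x < N"
  shows "occ adj (t @ [m]) (L @ N # R) =
    occ adj (t @ [m]) L \<union> map (\<lambda>i. i + Suc (length L)) ` occ adj (t @ [m]) R
      \<union> (\<lambda>js. js @ [length L]) ` occ adj t L" (is "?A = ?B \<union> ?C \<union> ?D")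
proof (intro equalityI subsetI)
  let ?w = "L @ N # R" and ?l = "length L"
  have wR: "?w ! (Suc (i + ?l)) = R ! i" for i
    by (simp add: nth_append)
  fix "is" assume A: "is \<in> ?A"
  let ?z = "is ! length t"
  have len: "length is = Suc (length t)" using occD(1)[OF A] by simp
  have mono: "is ! a < is ! b" if "a < b" "b \<le> length t" for a b
    using sorted_wrt_nth_less[OF occD(2)[OF A]] that len by simp
  have bound: "is ! a < length ?w" if "a \<le> length t" for a
    using occD(3)[OF A nth_mem[of a "is"]] that len by simp
  have iso: "?w ! (is ! a) < ?w ! (is ! b) \<longleftrightarrow> (t @ [m]) ! a < (t @ [m]) ! b"
    if "a \<le> length t" "b \<le> length t" for a b
    using occD(4)[OF A, of a b] that by simp
  have top: "?w ! (is ! a) < ?w ! ?z" if "a < length t" for a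
    using iso[of a "length t"] t(2)[of "t ! a"] that by (simp add: nth_append)
  consider "?z < ?l" | "?z = ?l" | "?z > ?l" by linarith
  then show "is \<in> ?B \<union> ?C \<union> ?D"
  proof cases
    case 1
    have lt: "is ! a < ?l" if "a \<le> length t" for a
      using mono[of a "length t"] that 1 by (cases "a = length t") auto
    have "is \<in> ?B"
    proof (rule occI)
      show "i < length L" if "i \<in> set is" for i
        using that lt len by (auto simp: in_set_conv_nth)
      show "L ! (is ! a) < L ! (is ! b) \<longleftrightarrow> (t @ [m]) ! a < (t @ [m]) ! b"
        if "a < length (t @ [m])" "b < length (t @ [m])" for a b
        using that lt[of a] lt[of b] iso[of a b] by (simp add: nth_append[of L])
    qed (use occD[OF A] in auto)
    then show ?thesis by simp
  next
    case 2
    define js where "js = butlast is"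
    have js: "is = js @ [?l]"
      using len 2 unfolding js_def by (metis append_butlast_last_id diff_Suc_1 last_conv_nth length_0_conv nat.distinct(1))
    have lj: "length js = length t" using len js by simp
    have nj: "js ! a = is ! a" if "a < length t" for a
      using that lj js by (simp add: nth_append)
    have lt: "js ! a < ?l" if "a < length t" for a
      using mono[of a "length t"] that 2 nj by auto
    have "js \<in> occ adj t L"
    proof (rule occI)
      show "i < length L" if "i \<in> set js" for i
        using that lt lj by (auto simp: in_set_conv_nth)
      show "L ! (js ! a) < L ! (js ! b) \<longleftrightarrow> t ! a < t ! b"
        if "a < length t" "b < length t" for a b
        using that lt[of a] lt[of b] iso[of a b] nj by (simp add: nth_append)
      show "sorted_wrt (<) js" using occD(2)[OF A] js by (simp add: sorted_wrt_append)
      show "js ! 1 = Suc (js ! 0)" if adj using occD(5)[OF A that] nj t(1) by (metis One_nat_def Suc_1 Suc_le_lessD Suc_lessD)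
    qed (use lj in auto)
    then show ?thesis using js by auto
  next
    case 3
    \<comment> \<open>An index up to \<open>?l\<close> carries \<open>N\<close> or a letter of
      \<open>L\<close>, all of which exceed the letter of \<open>R\<close> at \<open>?z\<close>,
      against \<open>top\<close>.\<close>
    have gt: "is ! a > ?l" if "a \<le> length t" for a
    proof (cases "a = length t")
      case False
      with that have a: "a < length t" by simp
      obtain d where d: "?z = Suc (d + ?l)" using 3 less_imp_Suc_add by (metis add.commute)
      then have dR: "d < length R" using bound[of "length t"] by simp
      then have wz: "?w ! ?z = R ! d" using d wR by simp
      show ?thesis
      proof (rule ccontr)
        assume "\<not> ?l < is ! a"
        then have "?w ! (is ! a) \<in> set L \<or> ?w ! (is ! a) = N" by (auto simp: nth_append)
        then have "?w ! ?z < ?w ! (is ! a)" using LR N wz dR by (auto simp: nth_mem)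
        then show False using top[OF a] by simp
      qed
    qed (use 3 in simp)
    define js where "js = map (\<lambda>i. i - Suc ?l) is"
    have js: "is = map (\<lambda>i. i + Suc ?l) js"
    proof (rule nth_equalityI)
      show "is ! a = map (\<lambda>i. i + Suc ?l) js ! a" if "a < length is" for a
        using gt[of a] that len by (simp add: js_def)
    qed (simp add: js_def)
    have lj: "length js = Suc (length t)" using len by (simp add: js_def)
    have nj: "is ! a = Suc (js ! a + ?l)" if "a \<le> length t" for a
      using that lj js by (metis add_Suc_right less_Suc_eq_le nth_map)
    have "js \<in> occ adj (t @ [m]) R"
    proof (rule occI)
      show "i < length R" if i: "i \<in> set js" for i
      proof -
        obtain a where "a \<le> length t" "i = js ! a" using i lj by (auto simp: in_set_conv_nth less_Suc_eq_le)
        then show ?thesis using bound[of a] nj[of a] by simp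
      qed
      show "R ! (js ! a) < R ! (js ! b) \<longleftrightarrow> (t @ [m]) ! a < (t @ [m]) ! b"
        if "a < length (t @ [m])" "b < length (t @ [m])" for a b
        using that iso[of a b] nj[of a] nj[of b] wR by simp
      show "sorted_wrt (<) js" using occD(2)[OF A] js by (simp add: sorted_wrt_map)
      show "js ! 1 = Suc (js ! 0)" if adj using occD(5)[OF A that] nj[of 0] nj[of 1] t(1) by simp
    qed (use lj in auto)
    then show ?thesis using js by auto
  qed
next
  let ?w = "L @ N # R" and ?l = "length L"
  have wR: "?w ! (Suc (i + ?l)) = R ! i" for i
    by (simp add: nth_append)
  have wL: "?w ! i = L ! i" if "i < ?l" for i
    using that by (simp add: nth_append)
  fix "is" assume "is \<in> ?B \<union> ?C \<union> ?D"
  then consider (B) "is \<in> ?B" | (C) js where "js \<in> occ adj (t @ [m]) R" "is = map (\<lambda>i. i + Suc ?l) js"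
    | (D) js where "js \<in> occ adj t L" "is = js @ [?l]" by auto
  then show "is \<in> ?A"
  proof cases
    case B
    have lt: "is ! a < ?l" if "a < length (t @ [m])" for a
      using occD(1)[OF B] occD(3)[OF B nth_mem[of a "is"]] that by simp
    show ?thesis
    proof (rule occI)
      show "i < length ?w" if "i \<in> set is" for i using occD(3)[OF B that] by simp
      show "?w ! (is ! a) < ?w ! (is ! b) \<longleftrightarrow> (t @ [m]) ! a < (t @ [m]) ! b"
        if "a < length (t @ [m])" "b < length (t @ [m])" for a b
        unfolding wL[OF lt[OF that(1)]] wL[OF lt[OF that(2)]] using occD(4)[OF B that] .
    qed (use occD[OF B] in auto)
  next
    case C
    note J = occD[OF C(1)]
    show ?thesis
    proof (rule occI)
      show "i < length ?w" if "i \<in> set is" for i using J(3) that C(2) by auto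
      show "?w ! (is ! a) < ?w ! (is ! b) \<longleftrightarrow> (t @ [m]) ! a < (t @ [m]) ! b"
        if "a < length (t @ [m])" "b < length (t @ [m])" for a b
        using J(4)[OF that] J(1) that C(2) wR by simp
      show "sorted_wrt (<) is" using J(2) C(2) by (simp add: sorted_wrt_map)
      have "0 < length js" "1 < length js" using J(1) t(1) by (auto simp: Suc_le_eq)
      then have "is ! a = js ! a + Suc ?l" if "a \<in> {0, 1}" for a using that C(2) by auto
      then show "is ! 1 = Suc (is ! 0)" if adj using J(5)[OF that] by simp
    qed (use J(1) C(2) in auto)
  next
    case D
    note J = occD[OF D(1)]
    have jl: "js ! a < ?l" if "a < length t" for a
      using J(1) J(3)[OF nth_mem[of a js]] that by simp
    have lo: "?w ! (is ! a) = L ! (js ! a)" if "a < length t" for a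
      using that J(1) D(2) wL[OF jl[OF that]] by (simp add: nth_append[of js])
    have hi: "?w ! (is ! length t) = N" using J(1) D(2) by (metis nth_append_length)
    have LN: "L ! (js ! a) < N" if "a < length t" for a
      using N jl[OF that] by simp
    show ?thesis
    proof (rule occI)
      show "i < length ?w" if "i \<in> set is" for i using J(3) that D(2) by fastforce
      show "?w ! (is ! a) < ?w ! (is ! b) \<longleftrightarrow> (t @ [m]) ! a < (t @ [m]) ! b"
        if ab: "a < length (t @ [m])" "b < length (t @ [m])" for a b
      proof -
        have tm: "t ! a < m" if "a < length t" for a using t(2) that by simp
        consider "a < length t" "b < length t" | "a < length t" "b = length t"
          | "a = length t" "b < length t" | "a = length t" "b = length t"
          using ab by (auto simp: less_Suc_eq)
        then show ?thesis
        proof cases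
          case 1 then show ?thesis using lo J(4)[of a b] by (simp add: nth_append[of t])
        next
          case 2 then show ?thesis using lo[of a] hi LN[of a] tm[of a] by (simp add: nth_append[of t])
        next
          case 3 then show ?thesis using lo[of b] hi LN[of b] tm[of b] by (simp add: nth_append[of t])
        qed simp
      qed
      show "sorted_wrt (<) is" using J(2,3) D(2) by (simp add: sorted_wrt_append)
      have "0 < length js" "1 < length js" using J(1) t(1) by (auto simp: Suc_le_eq)
      then show "is ! 1 = Suc (is ! 0)" if adj using J(5)[OF that] D(2) by (simp add: nth_append)
    qed (use J(1) D(2) in auto)
  qed
qed

text \<open>The three families are disjoint because their last index is below, above or equal to
  \<open>length L\<close>.\<close>

lemma card_occ_append_max:
  assumes t: "length t \<ge> 2" "\<And>y. y \<in> set t \<Longrightarrow> y < m"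
    and LR: "\<And>x y. x \<in> set L \<Longrightarrow> y \<in> set R \<Longrightarrow> y < x"
    and N: "\<And>x. x \<in> set L \<union> set R \<Longrightarrow> x < N"
  shows "card (occ adj (t @ [m]) (L @ N # R)) =
    card (occ adj (t @ [m]) L) + card (occ adj (t @ [m]) R) + card (occ adj t L)"
proof -
  let ?B = "occ adj (t @ [m]) L"
  let ?C = "map (\<lambda>i. i + Suc (length L)) ` occ adj (t @ [m]) R"
  let ?D = "(\<lambda>js. js @ [length L]) ` occ adj t L"
  have ne: "js \<noteq> []" "last js \<in> set js" if "js \<in> occ adj (t @ [m]) w" for js w
    using occD(1)[OF that] by (auto intro!: last_in_set)
  have B: "last js < length L" if "js \<in> ?B" for js
    using occD(3)[OF that ne(2)[OF that]] .
  have C: "last js > length L" if "js \<in> ?C" for js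
    using that ne by (auto simp: last_map)
  have D: "last js = length L" if "js \<in> ?D" for js
    using that by auto
  have disj: "?B \<inter> ?C = {}" "(?B \<union> ?C) \<inter> ?D = {}"
    using B C D by fastforce+
  have "card (occ adj (t @ [m]) (L @ N # R)) = card (?B \<union> ?C \<union> ?D)"
    using occ_append_max[OF assms] by simp
  also have "\<dots> = card ?B + card ?C + card ?D"
    using disj by (simp add: card_Un_disjoint finite_occ)
  also have "card ?C = card (occ adj (t @ [m]) R)"
    by (intro card_image inj_on_subset[OF inj_mapI subset_UNIV]) (auto simp: inj_def)
  also have "card ?D = card (occ adj t L)"
    by (intro card_image) (auto simp: inj_on_def)
  finally show ?thesis .
qed

subsection \<open>Alternating permutations avoiding 1-3-2\<close>

definition avoids_132 :: "nat list \<Rightarrow> bool" where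
  "avoids_132 \<pi> \<longleftrightarrow> (\<forall>i j l. i < j \<longrightarrow> j < l \<longrightarrow> l < length \<pi> \<longrightarrow> \<not> (\<pi> ! i < \<pi> ! l \<and> \<pi> ! l < \<pi> ! j))"

text \<open>Avoidance is defined by cardinality 0, which \<open>card\<close> also assigns to
  infinite sets; finiteness turns it into emptiness.\<close>

lemma finite_occurrences: "finite (occurrences p \<pi>)"
  by (rule finite_subset[OF _ finite_lists_length_eq[of "{..<length \<pi>}" "length (concat p)"]])
    (auto simp: occurrences_def Let_def)

lemma avoids_132_iff: "avoids [[1], [3], [2]] \<pi> \<longleftrightarrow> avoids_132 \<pi>"
proof -
  have less3: "(\<forall>a<Suc (Suc (Suc 0)). P a) \<longleftrightarrow> P 0 \<and> P 1 \<and> P 2" for P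
    by (auto simp: less_Suc_eq numeral_2_eq_2)
  have d: "dashes [[1], [3], [2]] = {1, 2}"
  proof -
    have "{m::nat. 0 < m \<and> m < 3} = {1, 2}" by auto
    moreover have "dashes [[1], [3], [2]] =
        (\<lambda>m. length (concat (take m [[1], [3], [2::nat]]))) ` {m. 0 < m \<and> m < 3}"
      unfolding dashes_def by auto
    ultimately show ?thesis by (simp add: numeral_2_eq_2)
  qed
  have "is \<in> occurrences [[1], [3], [2]] \<pi> \<longleftrightarrow> (\<exists>i j l. is = [i, j, l] \<and> i < j \<and> j < l \<and> l < length \<pi>
      \<and> \<pi> ! i < \<pi> ! l \<and> \<pi> ! l < \<pi> ! j)" for "is"
  proof (cases "length is = 3")
    case True
    then obtain i j l where "is = [i, j, l]"
      by (auto simp: numeral_3_eq_3 length_Suc_conv)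
    then show ?thesis
      unfolding occurrences_def Let_def d by (auto simp: less3)
  qed (auto simp: occurrences_def Let_def)
  then have "occurrences [[1], [3], [2]] \<pi> = {} \<longleftrightarrow> avoids_132 \<pi>"
    unfolding avoids_132_def by blast
  then show ?thesis
    by (simp add: avoids_def contains_exactly_def finite_occurrences)
qed

text \<open>Unlike \<open>up_down_perms\<close> and \<open>up_up_perms\<close>, this includes
  lengths 0 and 1, since such words occur as factors around the maximum.\<close>

definition alt132 :: "nat \<Rightarrow> nat list set" where
  "alt132 n = {\<pi> \<in> permutations_of_set {1..n}. up_alternating \<pi> \<and> avoids_132 \<pi>}"

lemma alt132D:
  assumes "\<pi> \<in> alt132 n"
  shows "length \<pi> = n" "set \<pi> = {1..n}" "distinct \<pi>" "up_alternating \<pi>" "avoids_132 \<pi>"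
  using assms by (auto simp: alt132_def permutations_of_set_def dest: distinct_card)

lemma alt132I:
  assumes "set \<pi> = {1..n}" "distinct \<pi>" "up_alternating \<pi>" "avoids_132 \<pi>"
  shows "\<pi> \<in> alt132 n"
  using assms by (auto simp: alt132_def permutations_of_set_def)

lemma finite_alt132: "finite (alt132 n)"
  by (auto simp: alt132_def)

lemma alt132_0: "alt132 0 = {[]}"
  by (auto simp: alt132_def up_alternating_def avoids_132_def permutations_of_set_def)

lemma alt132_1: "alt132 (Suc 0) = {[1]}"
proof -
  have "[1] \<in> alt132 (Suc 0)"
    by (rule alt132I) (auto simp: up_alternating_def avoids_132_def)
  moreover have "\<pi> = [1]" if p: "\<pi> \<in> alt132 (Suc 0)" for \<pi>
  proof -
    obtain x where x: "\<pi> = [x]" using alt132D(1)[OF p] by (metis length_0_conv length_Suc_conv)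
    moreover have "set \<pi> = {1}" using alt132D(2)[OF p] by simp
    ultimately show ?thesis by simp
  qed
  ultimately show ?thesis by blast
qed

text \<open>Inverse of the factorization around the maximum. The shift lifts the left factor above
  the right one, as avoidance of 1-3-2 demands.\<close>

definition glue :: "nat list \<Rightarrow> nat list \<Rightarrow> nat list" where
  "glue L R = map ((+) (length R)) L @ Suc (length L + length R) # R"

text \<open>As \<open>length L\<close> is odd, \<open>N\<close> stands at an odd index, a peak, and
  \<open>R\<close> starts at an even index, so parities inside \<open>R\<close> are kept.\<close>

lemma up_alternating_append_max:
  assumes "odd (length L)" and "\<And>x. x \<in> set L \<union> set R \<Longrightarrow> x < N"
  shows "up_alternating (L @ N # R) \<longleftrightarrow> up_alternating L \<and> up_alternating R"
proof -
  let ?w = "L @ N # R" and ?l = "length L"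
  let ?P = "\<lambda>w i. if even i then w ! i < w ! Suc i else w ! i > w ! Suc i"
  have wR: "?w ! (Suc (?l + i)) = R ! i" for i
    by (simp add: nth_append)
  have L: "?P ?w i \<longleftrightarrow> ?P L i" if "Suc i < ?l" for i
    using that by (simp add: nth_append)
  have R: "?P ?w (Suc (?l + i)) \<longleftrightarrow> ?P R i" for i
    using assms(1) wR[of i] wR[of "Suc i"] by auto
  \<comment> \<open>\<open>M1\<close> and \<open>M2\<close> treat the two comparisons that involve
    \<open>N\<close>; both hold because \<open>N\<close> is a maximum at an odd index.\<close>
  have M1: "?P ?w i" if "Suc i = ?l" for i
  proof -
    have "even i" using that assms(1) by presburger
    moreover have "?w ! i < N" using that assms(2) by (simp add: nth_append)
    ultimately show ?thesis using that by (simp add: nth_append)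
  qed
  have M2: "?P ?w ?l" if "Suc ?l < length ?w"
    using that assms wR[of 0] by simp
  have "up_alternating ?w \<longleftrightarrow> (\<forall>i. Suc i < length ?w \<longrightarrow> ?P ?w i)"
    by (simp add: up_alternating_def)
  also have "\<dots> \<longleftrightarrow> (\<forall>i. Suc i < ?l \<longrightarrow> ?P ?w i) \<and> (\<forall>i. Suc i < length R \<longrightarrow> ?P ?w (Suc (?l + i)))"
    (is "_ \<longleftrightarrow> ?X")
  proof
    assume X: ?X
    show "\<forall>i. Suc i < length ?w \<longrightarrow> ?P ?w i"
    proof (intro allI impI)
      fix i assume i: "Suc i < length ?w"
      consider "Suc i < ?l" | "Suc i = ?l" | "i = ?l" | "i > ?l" by linarith
      then show "?P ?w i"
      proof cases
        case 4
        then obtain d where d: "i = Suc (?l + d)" using less_imp_Suc_add by blast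
        then have "Suc d < length R" using i by simp
        then show ?thesis using X d by blast
      qed (use X M1 M2 i in blast)+
    qed
  next
    assume Y: "\<forall>i. Suc i < length ?w \<longrightarrow> ?P ?w i"
    show ?X
    proof (intro conjI allI impI)
      fix i assume "Suc i < ?l"
      then have "Suc i < length ?w" by simp
      then show "?P ?w i" using Y by blast
    next
      fix i assume "Suc i < length R"
      then have "Suc (Suc (?l + i)) < length ?w" by simp
      then show "?P ?w (Suc (?l + i))" using Y by blast
    qed
  qed
  also have "\<dots> \<longleftrightarrow> up_alternating L \<and> up_alternating R"
    using L R unfolding up_alternating_def by simp
  finally show ?thesis .
qed

text \<open>A letter of \<open>L\<close>, then \<open>N\<close>, then a larger letter of
  \<open>R\<close> would form 1-3-2. Conversely, with \<open>L\<close> above \<open>R\<close> no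
  occurrence can use letters from both sides or \<open>N\<close>.\<close>

lemma avoids_132_append_max:
  assumes d: "distinct (L @ N # R)" and N: "\<And>x. x \<in> set L \<union> set R \<Longrightarrow> x < N"
  shows "avoids_132 (L @ N # R) \<longleftrightarrow>
    avoids_132 L \<and> avoids_132 R \<and> (\<forall>x\<in>set L. \<forall>y\<in>set R. y < x)"
proof -
  let ?w = "L @ N # R" and ?l = "length L"
  have wR: "?w ! (Suc (?l + i)) = R ! i" for i
    by (simp add: nth_append)
  have wL: "?w ! i = L ! i" if "i < ?l" for i
    using that by (simp add: nth_append)
  have wN: "?w ! ?l = N" by simp
  show ?thesis
  proof
    assume A: "avoids_132 ?w"
    have "avoids_132 L"
      unfolding avoids_132_def
    proof (intro allI impI)
      fix i j l assume "i < j" "j < l" "l < length L"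
      then show "\<not> (L ! i < L ! l \<and> L ! l < L ! j)"
        using A[unfolded avoids_132_def, rule_format, of i j l] by (simp add: wL)
    qed
    moreover have "avoids_132 R"
      unfolding avoids_132_def
    proof (intro allI impI)
      fix i j l assume "i < j" "j < l" "l < length R"
      then show "\<not> (R ! i < R ! l \<and> R ! l < R ! j)"
        using A[unfolded avoids_132_def, rule_format, of "Suc (?l + i)" "Suc (?l + j)" "Suc (?l + l)"]
        unfolding wR by simp
    qed
    moreover have "y < x" if x: "x \<in> set L" and y: "y \<in> set R" for x y
    proof -
      obtain i where i: "i < ?l" "L ! i = x" using x by (auto simp: in_set_conv_nth)
      obtain l where l: "l < length R" "R ! l = y" using y by (auto simp: in_set_conv_nth)
      have "\<not> (x < y \<and> y < N)"
        using A[unfolded avoids_132_def, rule_format, of i ?l "Suc (?l + l)"] i l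
        unfolding wR wN wL[OF i(1)] by simp
      moreover have "x \<noteq> y" using d x y by auto
      ultimately show ?thesis using N y by force
    qed
    ultimately show "avoids_132 L \<and> avoids_132 R \<and> (\<forall>x\<in>set L. \<forall>y\<in>set R. y < x)" by blast
  next
    assume A: "avoids_132 L \<and> avoids_132 R \<and> (\<forall>x\<in>set L. \<forall>y\<in>set R. y < x)"
    show "avoids_132 ?w"
      unfolding avoids_132_def
    proof (intro allI impI)
      fix i j l assume ijl: "i < j" "j < l" "l < length ?w"
      show "\<not> (?w ! i < ?w ! l \<and> ?w ! l < ?w ! j)"
      proof
        assume B: "?w ! i < ?w ! l \<and> ?w ! l < ?w ! j"
        consider "l < ?l" | "l = ?l" | "l > ?l" by linarith
        then show False
        proof cases
          case 1
          then show False using A B ijl unfolding avoids_132_def by (auto simp: wL)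
        next
          case 2
          then have "?w ! j < N" using ijl N by (simp add: wL)
          then show False using B 2 by simp
        next
          case 3
          then obtain l' where l': "l = Suc (?l + l')" using less_imp_Suc_add by blast
          then have lR: "l' < length R" "?w ! l = R ! l'" using ijl wR by auto
          \<comment> \<open>Otherwise the first letter would exceed every letter of
            \<open>R\<close>, in particular the last one; so the whole occurrence lies in
            \<open>R\<close>.\<close>
          have "i > ?l"
          proof (rule ccontr)
            assume "\<not> i > ?l"
            then have "?w ! i \<in> set L \<or> ?w ! i = N" by (auto simp: nth_append)
            then have "?w ! l < ?w ! i" using A N lR by auto
            then show False using B by simp
          qed
          then obtain i' where i': "i = Suc (?l + i')" using less_imp_Suc_add by blast
          obtain j' where j': "j = Suc (?l + j')" using less_imp_Suc_add[of ?l j] \<open>i > ?l\<close> ijl by auto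
          show False using A B ijl l' i' j' unfolding avoids_132_def by (auto simp: wR)
        qed
      qed
    qed
  qed
qed

section \<open>The factorization around the maximum as a bijection\<close>

lemma up_alternating_map_add: "up_alternating (map ((+) c) \<pi>) \<longleftrightarrow> up_alternating \<pi>"
  unfolding up_alternating_def by (intro all_cong1) auto

lemma avoids_132_map_add: "avoids_132 (map ((+) c) \<pi>) \<longleftrightarrow> avoids_132 \<pi>"
  unfolding avoids_132_def by (intro all_cong1) auto

lemma set_map_add_alt132: "L \<in> alt132 i \<Longrightarrow> set (map ((+) c) L) = {Suc c..c + i}"
  using alt132D(2)[of L i] by (simp add: image_add_atLeastAtMost)

lemma glue_mem_alt132:
  assumes L: "L \<in> alt132 i" and R: "R \<in> alt132 l" and i: "odd i"
  shows "glue L R \<in> alt132 (Suc (i + l))"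
proof -
  note l = alt132D[OF L] and r = alt132D[OF R]
  let ?L = "map ((+) (length R)) L" and ?N = "Suc (i + l)"
  have g: "glue L R = ?L @ ?N # R" using l r by (simp add: glue_def)
  have sL: "set ?L = {Suc l..l + i}" using set_map_add_alt132[OF L] r by simp
  have N: "x < ?N" if "x \<in> set ?L \<union> set R" for x
  proof -
    have "x \<in> {Suc l..l + i} \<union> {1..l}" using that sL r(2) by blast
    then show ?thesis by auto
  qed
  have dist: "distinct (?L @ ?N # R)"
    using l(3) r(3) N sL r(2) by (auto simp: distinct_map)
  show ?thesis unfolding g
  proof (rule alt132I[OF _ dist])
    show "set (?L @ ?N # R) = {1..?N}" unfolding set_append sL list.set r(2) by auto
    show "up_alternating (?L @ ?N # R)"
      using up_alternating_append_max[of ?L R ?N] N i l r by (simp add: up_alternating_map_add)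
    have "\<forall>x\<in>set ?L. \<forall>y\<in>set R. y < x" unfolding sL r(2) by auto
    then show "avoids_132 (?L @ ?N # R)"
      using avoids_132_append_max[OF dist N] l r by (simp add: avoids_132_map_add)
  qed
qed

lemma down_closed_eq_atLeastAtMost:
  fixes A :: "nat set"
  assumes "finite A" "0 \<notin> A" and "\<And>x y. x \<in> A \<Longrightarrow> 0 < y \<Longrightarrow> y < x \<Longrightarrow> y \<in> A"
  shows "A = {1..card A}"
proof (cases "A = {}")
  case False
  have "A = {1..Max A}"
  proof (intro equalityI subsetI)
    fix x assume "x \<in> A"
    then show "x \<in> {1..Max A}" using assms(1,2) by (cases x) auto
  next
    fix x assume "x \<in> {1..Max A}"
    then show "x \<in> A" using assms(3)[OF Max_in[OF assms(1) False], of x] Max_in[OF assms(1) False]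
      by (cases "x = Max A") auto
  qed
  then show ?thesis by (metis card_atLeastAtMost diff_Suc_1)
qed simp

lemma alt132_decompose:
  assumes "\<pi> \<in> alt132 n" and n: "n \<ge> 2"
  obtains i L R where "odd i" "i < n" "L \<in> alt132 i" "R \<in> alt132 (n - 1 - i)" "\<pi> = glue L R"
proof -
  note p = alt132D[OF assms(1)]
  have "n \<in> set \<pi>" using p n by simp
  then obtain L' R where \<pi>: "\<pi> = L' @ n # R" by (meson split_list)
  have N: "x < n" if "x \<in> set L' \<union> set R" for x
  proof -
    have "x \<in> {1..n}" using that p(2) \<pi> by auto
    moreover have "x \<noteq> n" using that p(3) \<pi> by auto
    ultimately show ?thesis by simp
  qed
  define i where "i = length L'"
  define r where "r = length R"
  have n_eq: "n = Suc (i + r)" using p(1) \<pi> by (simp add: i_def r_def)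
  have odd: "odd i"
  proof
    assume ev: "even i"
    show False
    \<comment> \<open>At an even index the maximum would have to lie below a neighbour: the right
      one if \<open>R\<close> is nonempty, otherwise the left one, which exists since
      \<open>n \<ge> 2\<close>.\<close>
    proof (cases "R = []")
      case True
      then obtain j where j: "i = Suc j" using n_eq n r_def by (cases i) auto
      then have "\<pi> ! j > \<pi> ! Suc j" using p(4) ev n_eq p(1) unfolding up_alternating_def by auto
      moreover have "\<pi> ! j < n" using N[of "L' ! j"] j \<pi> by (simp add: nth_append i_def)
      moreover have "\<pi> ! Suc j = n" using j \<pi> by (metis i_def nth_append_length)
      ultimately show False by simp
    next
      case False
      then have "\<pi> ! i < \<pi> ! Suc i" using p(1,4) ev n_eq r_def unfolding up_alternating_def by auto
      moreover have "\<pi> ! i = n" using \<pi> i_def by simp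
      moreover have "\<pi> ! Suc i < n" using N[of "R ! 0"] False \<pi> i_def by (simp add: nth_append)
      ultimately show False by simp
    qed
  qed
  have av: "avoids_132 L'" "avoids_132 R" "\<And>x y. x \<in> set L' \<Longrightarrow> y \<in> set R \<Longrightarrow> y < x"
    using avoids_132_append_max[of L' n R] N p(3,5) \<pi> by auto
  have up: "up_alternating L'" "up_alternating R"
    using up_alternating_append_max[of L' R n] N p(4) \<pi> odd i_def by auto
  have un: "set L' \<union> set R = {1..<n}"
  proof -
    have "insert n (set L' \<union> set R) = {1..n}" using p(2) \<pi> by auto
    moreover have "n \<notin> set L' \<union> set R" using N by blast
    ultimately have "set L' \<union> set R = {1..n} - {n}" by blast
    also have "\<dots> = {1..<n}" by auto
    finally show ?thesis .
  qed
  have dis: "distinct L'" "distinct R" "set L' \<inter> set R = {}" using p(3) \<pi> by auto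
  \<comment> \<open>A value below a letter of \<open>R\<close> cannot come from \<open>L'\<close>,
    whose letters all exceed those of \<open>R\<close>; hence \<open>R\<close> carries an initial
    segment of the values.\<close>
  have "set R = {1..card (set R)}"
  proof (rule down_closed_eq_atLeastAtMost)
    have "0 \<notin> set L' \<union> set R" unfolding un by simp
    then show "0 \<notin> set R" by simp
    show "y \<in> set R" if "x \<in> set R" "0 < y" "y < x" for x y
    proof -
      have "x < n" using N that(1) by blast
      then have "y \<in> set L' \<union> set R" unfolding un using that by simp
      then show ?thesis using av(3)[of y x] that by auto
    qed
  qed simp
  then have sR: "set R = {1..r}" using dis by (simp add: distinct_card r_def)
  have sL': "set L' = {Suc r..r + i}"
  proof -
    have "set L' = {1..<n} - {1..r}" using un dis(3) sR by blast
    also have "\<dots> = {Suc r..r + i}" using n_eq by auto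
    finally show ?thesis .
  qed
  \<comment> \<open>Standardization; all letters of \<open>L'\<close> exceed \<open>r\<close>, so
    truncated subtraction loses nothing.\<close>
  define L where "L = map (\<lambda>x. x - r) L'"
  have L': "L' = map ((+) r) L"
    unfolding L_def using sL' by (auto simp: comp_def intro!: map_idI[symmetric])
  have "set L = {1..i}"
  proof -
    have "(+) r ` set L = {Suc r..r + i}" using sL' L' by (metis set_map)
    also have "\<dots> = (+) r ` {1..i}" by (simp add: add.commute)
    finally show ?thesis by (simp only: inj_image_eq_iff[OF inj_on_add])
  qed
  moreover have "distinct L" "up_alternating L" "avoids_132 L"
    using dis(1) av(1) up(1) L' by (metis distinct_map up_alternating_map_add avoids_132_map_add)+
  ultimately have "L \<in> alt132 i" by (rule alt132I)
  moreover have "R \<in> alt132 (n - 1 - i)"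
  proof -
    have "n - 1 - i = r" using n_eq by simp
    then show ?thesis using alt132I[OF sR dis(2) up(2) av(2)] by simp
  qed
  moreover have "\<pi> = glue L R"
  proof -
    have "length L = i" by (simp add: L_def i_def)
    then show ?thesis using \<pi> L' n_eq by (simp add: glue_def flip: r_def)
  qed
  moreover have "i < n" using n_eq by simp
  ultimately show ?thesis using odd that by blast
qed

text \<open>The maximum occurs once, so it fixes where the word splits; the right factor then
  reveals the shift of the left one.\<close>

lemma glue_inj:
  assumes "L \<in> alt132 i" "R \<in> alt132 r" "L' \<in> alt132 i'" "R' \<in> alt132 r'"
    and "i + r = i' + r'" and "glue L R = glue L' R'"
  shows "L = L' \<and> R = R'"
proof -
  note d = assms(1-4)[THEN alt132D(1)] assms(1-4)[THEN alt132D(2)]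
  have "Suc (i + r) \<notin> set (map ((+) r) L)" "Suc (i + r) \<notin> set R"
    using set_map_add_alt132[OF assms(1), of r] d by auto
  moreover have "Suc (i + r) \<notin> set (map ((+) r') L')" "Suc (i + r) \<notin> set R'"
    using set_map_add_alt132[OF assms(3), of r'] d assms(5) by auto
  ultimately have e: "map ((+) r) L = map ((+) r') L' \<and> R = R'"
    using assms(5,6) d by (simp add: glue_def append_Cons_eq_iff)
  then have "r = r'" using d by auto
  then show ?thesis using e by (auto dest: map_injective simp: inj_def)
qed

text \<open>Reindexing along the bijection \<open>glue\<close>. The maximum takes one letter, which
  leaves \<open>n - 1 - i\<close> for the right factor.\<close>

lemma sum_alt132:
  fixes f :: "nat list \<Rightarrow> 'a :: comm_monoid_add"
  assumes "n \<ge> 2"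
  shows "(\<Sum>\<pi>\<in>alt132 n. f \<pi>) =
    (\<Sum>i | i < n \<and> odd i. \<Sum>L\<in>alt132 i. \<Sum>R\<in>alt132 (n - 1 - i). f (glue L R))"
proof -
  let ?I = "{i. i < n \<and> odd i}"
  let ?D = "SIGMA i:?I. alt132 i \<times> alt132 (n - 1 - i)"
  have "bij_betw (\<lambda>(i, L, R). glue L R) ?D (alt132 n)"
    unfolding bij_betw_def
  proof
    show "inj_on (\<lambda>(i, L, R). glue L R) ?D"
    proof (rule inj_onI)
      fix x y assume x: "x \<in> ?D" and y: "y \<in> ?D"
        and eq: "(case x of (i, L, R) \<Rightarrow> glue L R) = (case y of (i, L, R) \<Rightarrow> glue L R)"
      obtain i L R where x': "x = (i, L, R)" by (rule prod_cases3)
      obtain i' L' R' where y': "y = (i', L', R')" by (rule prod_cases3)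
      have m: "L \<in> alt132 i" "R \<in> alt132 (n - 1 - i)" "L' \<in> alt132 i'" "R' \<in> alt132 (n - 1 - i')"
        and "i < n" "i' < n" "glue L R = glue L' R'"
        using x y eq x' y' by auto
      then have "L = L' \<and> R = R'"
        by (intro glue_inj[OF m]) auto
      then show "x = y" using alt132D(1)[OF m(1)] alt132D(1)[OF m(3)] x' y' by simp
    qed
    show "(\<lambda>(i, L, R). glue L R) ` ?D = alt132 n"
    proof (intro equalityI subsetI)
      fix \<pi> assume "\<pi> \<in> (\<lambda>(i, L, R). glue L R) ` ?D"
      then obtain i L R where *: "i < n" "odd i" "L \<in> alt132 i" "R \<in> alt132 (n - 1 - i)" "\<pi> = glue L R"
        by auto
      then have "\<pi> \<in> alt132 (Suc (i + (n - 1 - i)))" using glue_mem_alt132 by metis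
      moreover have "Suc (i + (n - 1 - i)) = n" using * by simp
      ultimately show "\<pi> \<in> alt132 n" by simp
    next
      fix \<pi> assume "\<pi> \<in> alt132 n"
      then obtain i L R where "odd i" "i < n" "L \<in> alt132 i" "R \<in> alt132 (n - 1 - i)" "\<pi> = glue L R"
        using alt132_decompose assms by metis
      then have "(i, L, R) \<in> ?D" "\<pi> = (\<lambda>(i, L, R). glue L R) (i, L, R)" by auto
      then show "\<pi> \<in> (\<lambda>(i, L, R). glue L R) ` ?D" by blast
    qed
  qed
  from sum.reindex_bij_betw[OF this, of f, symmetric]
  have "(\<Sum>\<pi>\<in>alt132 n. f \<pi>) = (\<Sum>(i, L, R)\<in>?D. f (glue L R))"
    by (simp add: case_prod_unfold)
  also have "\<dots> = (\<Sum>i\<in>?I. \<Sum>(L, R)\<in>alt132 i \<times> alt132 (n - 1 - i). f (glue L R))"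
    by (subst sum.Sigma) (auto simp: finite_alt132)
  finally show ?thesis by (simp add: sum.cartesian_product)
qed

subsection \<open>Generating functions\<close>

lemma card_occ_glue:
  assumes t: "length t \<ge> 2" "\<And>y. y \<in> set t \<Longrightarrow> y < m"
    and L: "L \<in> alt132 i" and R: "R \<in> alt132 l"
  shows "card (occ adj (t @ [m]) (glue L R)) =
    card (occ adj (t @ [m]) L) + card (occ adj (t @ [m]) R) + card (occ adj t L)"
proof -
  let ?L = "map ((+) (length R)) L" and ?N = "Suc (length L + length R)"
  have sL: "set ?L = {Suc l..l + i}" using set_map_add_alt132[OF L] alt132D(1)[OF R] by simp
  note d = alt132D(1,2)[OF R] alt132D(1)[OF L]
  have N: "x < ?N" if "x \<in> set ?L \<union> set R" for x
  proof -
    have "x \<in> {Suc l..l + i} \<union> {1..l}" using that sL d by blast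
    then show ?thesis using d by auto
  qed
  have LR: "y < x" if "x \<in> set ?L" "y \<in> set R" for x y
  proof -
    have "x \<in> {Suc l..l + i}" "y \<in> {1..l}" using that sL d by blast+
    then show ?thesis by simp
  qed
  have "card (occ adj (t @ [m]) (?L @ ?N # R)) =
      card (occ adj (t @ [m]) ?L) + card (occ adj (t @ [m]) R) + card (occ adj t ?L)"
    by (rule card_occ_append_max) (use t LR N in blast)+
  then show ?thesis by (simp only: glue_def occ_map_add)
qed

text \<open>The flag \<open>b\<close> selects the words of odd length (if true) or of even length (if false).\<close>
definition alt132_gf :: "bool \<Rightarrow> (nat list \<Rightarrow> real) \<Rightarrow> real fps" where
  "alt132_gf b f = Abs_fps (\<lambda>n. if odd n = b then \<Sum>\<pi>\<in>alt132 n. f \<pi> else 0)"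

lemma alt132_gf_nth:
  "fps_nth (alt132_gf b f) n = (if odd n = b then \<Sum>\<pi>\<in>alt132 n. f \<pi> else 0)"
  by (simp add: alt132_gf_def)

lemma alt132_gf_0 [simp]: "alt132_gf b (\<lambda>_. 0) = 0"
  by (rule fps_ext) (simp add: alt132_gf_nth)

text \<open>For \<open>n \<ge> 2\<close> the coefficients are Cauchy sums over the factorization,
  with \<open>fps_X\<close> accounting for the maximum; the words of length 0 and 1 give the initial
  term. Two products are provided because a single occurrence can arise in two exclusive
  ways.\<close>

lemma alt132_gf_rec:
  assumes "\<And>i l L R. odd i \<Longrightarrow> odd l = b \<Longrightarrow> L \<in> alt132 i \<Longrightarrow> R \<in> alt132 l \<Longrightarrow>
    f (glue L R) = a L * c R + a' L * c' R"
  shows "alt132_gf b f = (if b then fps_const (f [1]) * fps_X else fps_const (f []))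
    + fps_X * (alt132_gf True a * alt132_gf b c + alt132_gf True a' * alt132_gf b c')"
proof (rule fps_ext)
  fix n :: nat
  let ?A = "\<lambda>a i. \<Sum>L\<in>alt132 i. a L :: real"
  consider "n = 0" | "n = 1" | "n \<ge> 2" by linarith
  then show "fps_nth (alt132_gf b f) n = fps_nth ((if b then fps_const (f [1]) * fps_X else fps_const (f []))
    + fps_X * (alt132_gf True a * alt132_gf b c + alt132_gf True a' * alt132_gf b c')) n"
  proof cases
    case 1
    then show ?thesis by (simp add: alt132_gf_nth alt132_0)
  next
    case 2
    then show ?thesis by (simp add: alt132_gf_nth alt132_1)
  next
    case 3
    have conv: "fps_nth (alt132_gf True a * alt132_gf b c) (n - 1) =
       (if odd n = b then \<Sum>i | i < n \<and> odd i. ?A a i * ?A c (n - 1 - i) else 0)" for a c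
    proof -
      have "fps_nth (alt132_gf True a * alt132_gf b c) (n - 1) =
          (\<Sum>i\<in>{0..n - 1}. (if odd i then ?A a i else 0) * (if odd (n - 1 - i) = b then ?A c (n - 1 - i) else 0))"
        by (simp only: fps_mult_nth alt132_gf_nth simp_thms)
      also have "{0..n - 1} = {i. i < n}" using 3 by auto
      also have "(\<Sum>i | i < n. (if odd i then ?A a i else 0) * (if odd (n - 1 - i) = b then ?A c (n - 1 - i) else 0))
         = (\<Sum>i | i < n. if odd i then (if odd n = b then ?A a i * ?A c (n - 1 - i) else 0) else 0)"
      proof (rule sum.cong[OF refl])
        fix i assume "i \<in> {i. i < n}"
        \<comment> \<open>An odd left factor together with the maximum has even length, so the right
          factor inherits the parity of the word.\<close>
        then have "odd (n - 1 - i) = odd n" if "odd i" using that by auto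
        then show "(if odd i then ?A a i else 0) * (if odd (n - 1 - i) = b then ?A c (n - 1 - i) else 0) =
          (if odd i then (if odd n = b then ?A a i * ?A c (n - 1 - i) else 0) else 0)" by simp
      qed
      also have "\<dots> = (\<Sum>i\<in>{i. i < n} \<inter> {i. odd i}. if odd n = b then ?A a i * ?A c (n - 1 - i) else 0)"
        by (subst sum.inter_restrict) (auto intro!: sum.cong)
      also have "{i. i < n} \<inter> {i. odd i} = {i. i < n \<and> odd i}" by auto
      finally show ?thesis by simp
    qed
    have "(\<Sum>\<pi>\<in>alt132 n. f \<pi>) = (\<Sum>i | i < n \<and> odd i. ?A a i * ?A c (n - 1 - i))
        + (\<Sum>i | i < n \<and> odd i. ?A a' i * ?A c' (n - 1 - i))" if "odd n = b"
    proof -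
      have "(\<Sum>L\<in>alt132 i. \<Sum>R\<in>alt132 (n - 1 - i). f (glue L R)) =
         ?A a i * ?A c (n - 1 - i) + ?A a' i * ?A c' (n - 1 - i)" if i: "i < n" "odd i" for i
      proof -
        have "odd (n - 1 - i) = b" using i \<open>odd n = b\<close> by auto
        then have "(\<Sum>L\<in>alt132 i. \<Sum>R\<in>alt132 (n - 1 - i). f (glue L R)) =
            (\<Sum>L\<in>alt132 i. \<Sum>R\<in>alt132 (n - 1 - i). a L * c R + a' L * c' R)"
          using assms i by (intro sum.cong refl) blast
        then show ?thesis by (simp add: sum.distrib sum_product)
      qed
      then show ?thesis by (simp add: sum_alt132[OF 3] sum.distrib)
    qed
    moreover have "fps_nth ((if b then fps_const (f [1]) * fps_X else fps_const (f []))
        + fps_X * (alt132_gf True a * alt132_gf b c + alt132_gf True a' * alt132_gf b c')) n =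
      fps_nth (alt132_gf True a * alt132_gf b c) (n - 1) + fps_nth (alt132_gf True a' * alt132_gf b c') (n - 1)"
      using 3 by simp
    ultimately show ?thesis unfolding conv by (simp add: alt132_gf_nth)
  qed
qed

section \<open>Chebyshev polynomials at \<open>1 / (2 * fls_X)\<close>\<close>

lemma chebyshev_U_inv2X_0: "chebyshev_U_inv2X 0 = 1"
  by (simp add: chebyshev_U_inv2X_def chebyshev_U_eq_rec map_poly_1')

lemma chebyshev_U_inv2X_1: "chebyshev_U_inv2X (Suc 0) = 1 / fls_X"
  by (simp add: chebyshev_U_inv2X_def chebyshev_U_eq_rec map_poly_pCons)

text \<open>The factor \<open>[:0, 2:]\<close> of the polynomial recurrence evaluates to
  \<open>1 / fls_X\<close>.\<close>

lemma chebyshev_U_inv2X_Suc_Suc: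
  "chebyshev_U_inv2X (Suc (Suc r)) = chebyshev_U_inv2X (Suc r) / fls_X - chebyshev_U_inv2X r"
proof -
  have diff: "map_poly fls_const (p - q) = map_poly fls_const p - map_poly fls_const q" for p q :: "real poly"
    by (rule poly_eqI) (simp add: coeff_map_poly fls_minus_const)
  have mult: "map_poly fls_const ([:0, 2:] * p) = [:0, 2:] * map_poly fls_const p" for p :: "real poly"
    by (simp add: map_poly_pCons map_poly_smult)
  show ?thesis
    unfolding chebyshev_U_inv2X_def chebyshev_U_eq_rec chebyshev_U_rec.simps(3) diff mult
    by simp
qed

lemma alt132_3: "alt132 3 = {[2, 3, 1]}"
proof -
  have g: "glue [1] [1] = [2, 3, 1]" by (simp add: glue_def)
  have "[2, 3, 1] \<in> alt132 3"
    using glue_mem_alt132[of "[1]" "Suc 0" "[1]" "Suc 0"] g by (simp add: alt132_1 numeral_3_eq_3)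
  moreover have "\<pi> = [2, 3, 1]" if p: "\<pi> \<in> alt132 3" for \<pi>
  proof -
    obtain i L R where d: "odd i" "i < 3" "L \<in> alt132 i" "R \<in> alt132 (3 - 1 - i)" "\<pi> = glue L R"
      using alt132_decompose[OF p] by auto
    then have "i = Suc 0" by (auto simp: numeral_3_eq_3 less_Suc_eq)
    then show ?thesis using d g by (simp add: alt132_1)
  qed
  ultimately show ?thesis by blast
qed

section \<open>Solving the recursions for abstract occurrence statistics\<close>

lemma mult_one_minus_eqI:
  fixes y c x a :: "'a :: comm_ring_1"
  assumes "y = c + x * (a * y)"
  shows "y * (1 - x * a) = c"
proof -
  have "y * (1 - x * a) = y - x * (a * y)" by (simp add: algebra_simps)
  also have "\<dots> = c" using assms by (metis add_diff_cancel_right')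
  finally show ?thesis .
qed

text \<open>\<open>N k\<close> abstracts the number of occurrences of \<tau>-3-...-k, with
  \<open>N 2\<close> counting \<tau> itself. All four prefixes 12, 21, 1-2 and 2-1 are
  instances.\<close>

locale prefix_max_statistic =
  fixes N :: "nat \<Rightarrow> nat list \<Rightarrow> nat"
  assumes N_glue: "\<And>k i l L R. k \<ge> 3 \<Longrightarrow> L \<in> alt132 i \<Longrightarrow> R \<in> alt132 l \<Longrightarrow>
      N k (glue L R) = N k L + N k R + N (k - 1) L"
    and N_short: "\<And>k \<pi>. k \<ge> 2 \<Longrightarrow> length \<pi> < 2 \<Longrightarrow> N k \<pi> = 0"
begin

text \<open>A sum of three numbers, each 0 or at least 2, is never 1.\<close>

lemma N_neq_1:
  assumes base: "\<And>n \<pi>. odd n \<Longrightarrow> \<pi> \<in> alt132 n \<Longrightarrow> N 2 \<pi> \<noteq> 1"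
    and "k \<ge> 3" "\<pi> \<in> alt132 n"
  shows "N k \<pi> \<noteq> 1"
  using assms(2,3)
proof (induction n arbitrary: k \<pi> rule: less_induct)
  case (less n)
  show ?case
  proof (cases "n \<ge> 2")
    case True
    then obtain i L R where d: "odd i" "i < n" "L \<in> alt132 i" "R \<in> alt132 (n - 1 - i)" "\<pi> = glue L R"
      using alt132_decompose[OF less.prems(2)] by metis
    \<comment> \<open>For \<open>k = 3\<close> this summand is \<open>N 2 L\<close>, where
      \<open>base\<close> applies because the left factor has odd length.\<close>
    have "N (k - 1) L \<noteq> 1"
      using base[OF d(1,3)] less.IH[OF d(2), of "k - 1" L] d(3) less.prems(1)
      by (cases "k = 3") auto
    moreover have "N k L \<noteq> 1" using less.IH[OF d(2)] d less.prems by blast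
    moreover have "N k R \<noteq> 1" using less.IH[OF _ less.prems(1) d(4)] True by simp
    ultimately show ?thesis using N_glue[OF less.prems(1) d(3,4)] d(5) by auto
  next
    case False
    then show ?thesis using N_short[of k \<pi>] alt132D(1)[OF less.prems(2)] less.prems(1) by simp
  qed
qed

end

text \<open>Adds the values of \<open>N 2\<close> on odd lengths that 12, 21 and 1-2 share and that
  2-1 violates at length 3.\<close>

locale single_base_statistic = prefix_max_statistic +
  assumes N_2_3: "\<And>\<pi>. \<pi> \<in> alt132 3 \<Longrightarrow> N 2 \<pi> = 1"
    and N_2_ge_5: "\<And>n \<pi>. odd n \<Longrightarrow> n \<ge> 5 \<Longrightarrow> \<pi> \<in> alt132 n \<Longrightarrow> N 2 \<pi> \<ge> 2"
begin

lemma N_2_odd: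
  assumes "odd n" "\<pi> \<in> alt132 n"
  shows "N 2 \<pi> = 0 \<longleftrightarrow> n = 1" "N 2 \<pi> = 1 \<longleftrightarrow> n = 3"
proof -
  have "n = 1 \<or> n = 3 \<or> n \<ge> 5" using assms(1) by presburger
  then consider "n = 1" | "n = 3" | "n \<ge> 5" by blast
  then have "(N 2 \<pi> = 0 \<longleftrightarrow> n = 1) \<and> (N 2 \<pi> = 1 \<longleftrightarrow> n = 3)"
  proof cases
    case 1
    then show ?thesis using N_short[of 2 \<pi>] alt132D(1)[OF assms(2)] by simp
  next
    case 2
    then show ?thesis using N_2_3 assms by auto
  next
    case 3
    then show ?thesis using N_2_ge_5[OF assms(1) _ assms(2)] by auto
  qed
  then show "N 2 \<pi> = 0 \<longleftrightarrow> n = 1" "N 2 \<pi> = 1 \<longleftrightarrow> n = 3" by blast+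
qed

text \<open>Makes the recursions multiplicative: if \<open>N (k - 1) L \<le> 1\<close>, then
  \<open>N k L\<close> drops out of the count for \<open>glue L R\<close>.\<close>

lemma N_pred_ge_2:
  assumes "k \<ge> 3" "odd n" "\<pi> \<in> alt132 n" "N k \<pi> > 0"
  shows "N (k - 1) \<pi> \<ge> 2"
  using assms
proof (induction n arbitrary: k \<pi> rule: less_induct)
  case (less n)
  have "n \<ge> 2"
    using N_short[of k \<pi>] alt132D(1)[OF less.prems(3)] less.prems(1,4) by (rule_tac ccontr) simp
  then obtain i L R where d: "odd i" "i < n" "L \<in> alt132 i" "R \<in> alt132 (n - 1 - i)" "\<pi> = glue L R"
    using alt132_decompose[OF less.prems(3)] by metis
  have rodd: "odd (n - 1 - i)" using d less.prems(2) by auto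
  have L: "N (k - 1) L \<ge> 2" if "N k L > 0"
    using less.IH[OF d(2) less.prems(1) d(1,3) that] .
  have R: "N (k - 1) R \<ge> 2" if "N k R > 0"
    using less.IH[OF _ less.prems(1) rodd d(4) that] d by simp
  have pos: "N k L > 0 \<or> N k R > 0 \<or> N (k - 1) L > 0"
    using less.prems(4) N_glue[OF less.prems(1) d(3,4)] d(5) by auto
  show ?case
  proof (cases "k = 3")
    case True
    \<comment> \<open>For \<open>k = 3\<close> it suffices to exclude lengths 1 and 3. At length 3
      both factors have one letter, so no summand is positive.\<close>
    have "n \<noteq> 1" using \<open>n \<ge> 2\<close> by simp
    moreover have "n \<noteq> 3"
    proof
      assume n: "n = 3"
      then have "i = 1" using d(1,2) rodd by (auto simp: numeral_3_eq_3 less_Suc_eq)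
      then have "N 3 L = 0" "N 3 R = 0" "N 2 L = 0"
        using N_short alt132D(1)[OF d(3)] alt132D(1)[OF d(4)] n by auto
      then show False using pos True by simp
    qed
    ultimately have "N 2 \<pi> \<noteq> 0" "N 2 \<pi> \<noteq> 1" using N_2_odd[OF less.prems(2,3)] by auto
    then show ?thesis using True by simp
  next
    case False
    then have "k - 1 \<ge> 3" using less.prems(1) by simp
    \<comment> \<open>Whichever summand of \<open>N k \<pi>\<close> is positive, the induction
      hypothesis makes the matching summand here at least 2.\<close>
    then have "N (k - 1) \<pi> = N (k - 1) L + N (k - 1) R + N (k - 1 - 1) L"
      using N_glue[OF _ d(3,4)] d(5) by blast
    moreover have "N (k - 1 - 1) L \<ge> 2" if "N (k - 1) L > 0"
      using less.IH[OF d(2) \<open>k - 1 \<ge> 3\<close> d(1,3) that] .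
    ultimately show ?thesis using pos L R by linarith
  qed
qed

text \<open>Laurent series are used because the Chebyshev values involve negative powers of
  \<open>fls_X\<close>.\<close>

definition avoid_gf :: "bool \<Rightarrow> nat \<Rightarrow> real fls" where
  "avoid_gf b k = fps_to_fls (alt132_gf b (\<lambda>\<pi>. of_bool (N k \<pi> = 0)))"

definition once_gf :: "bool \<Rightarrow> nat \<Rightarrow> real fls" where
  "once_gf b k = fps_to_fls (alt132_gf b (\<lambda>\<pi>. of_bool (N k \<pi> = 1)))"

text \<open>\<open>N (k - 1) L = 0\<close> already forces \<open>N k L = 0\<close>, so the condition
  on \<open>glue L R\<close> is a product and the second product of \<open>alt132_gf_rec\<close> is
  set to zero.\<close>

lemma avoid_gf_rec:
  assumes k: "k \<ge> 3"
  shows "avoid_gf b k = (if b then fls_X else 1) + fls_X * (avoid_gf True (k - 1) * avoid_gf b k)"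
proof -
  have short: "N k [1] = 0" "N k [] = 0" using N_short k by auto
  have "alt132_gf b (\<lambda>\<pi>. of_bool (N k \<pi> = 0)) =
      (if b then fps_const (of_bool (N k [1] = 0)) * fps_X else fps_const (of_bool (N k [] = 0)))
      + fps_X * (alt132_gf True (\<lambda>\<pi>. of_bool (N (k - 1) \<pi> = 0)) * alt132_gf b (\<lambda>\<pi>. of_bool (N k \<pi> = 0))
        + alt132_gf True (\<lambda>_. 0) * alt132_gf b (\<lambda>_. 0))"
  proof (rule alt132_gf_rec)
    fix i l L R assume A: "odd i" "L \<in> alt132 i" "R \<in> alt132 l"
    have "N k L = 0" if "N (k - 1) L = 0" using N_pred_ge_2[OF k A(1,2)] that by force
    then show "of_bool (N k (glue L R) = 0) =
        of_bool (N (k - 1) L = 0) * of_bool (N k R = 0) + 0 * (0::real)"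
      using N_glue[OF k A(2,3)] by (cases "N (k - 1) L = 0") auto
  qed
  from arg_cong[OF this, of fps_to_fls] show ?thesis
    unfolding short avoid_gf_def by (cases b) (simp_all add: fls_times_fps_to_fls)
qed

text \<open>The single occurrence either ends at the maximum or lies in \<open>R\<close>. It cannot
  lie in \<open>L\<close>, as then \<open>N (k - 1) L \<ge> 2\<close>.\<close>

lemma once_gf_rec:
  assumes k: "k \<ge> 3"
  shows "once_gf b k = fls_X * once_gf True (k - 1) * avoid_gf b k + fls_X * (avoid_gf True (k - 1) * once_gf b k)"
proof -
  have short: "N k [1] = 0" "N k [] = 0" using N_short k by auto
  have "alt132_gf b (\<lambda>\<pi>. of_bool (N k \<pi> = 1)) =
      (if b then fps_const (of_bool (N k [1] = 1)) * fps_X else fps_const (of_bool (N k [] = 1)))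
      + fps_X * (alt132_gf True (\<lambda>\<pi>. of_bool (N (k - 1) \<pi> = 1)) * alt132_gf b (\<lambda>\<pi>. of_bool (N k \<pi> = 0))
        + alt132_gf True (\<lambda>\<pi>. of_bool (N (k - 1) \<pi> = 0)) * alt132_gf b (\<lambda>\<pi>. of_bool (N k \<pi> = 1)))"
  proof (rule alt132_gf_rec)
    fix i l L R assume A: "odd i" "L \<in> alt132 i" "R \<in> alt132 l"
    have "N k L = 0" if "N (k - 1) L < 2" using N_pred_ge_2[OF k A(1,2)] that by force
    then show "of_bool (N k (glue L R) = 1) =
        of_bool (N (k - 1) L = 1) * of_bool (N k R = 0) + of_bool (N (k - 1) L = 0) * (of_bool (N k R = 1) :: real)"
      using N_glue[OF k A(2,3)] by (cases "N (k - 1) L < 2") (auto simp: less_2_cases_iff)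
  qed
  from arg_cong[OF this, of fps_to_fls] show ?thesis
    unfolding short avoid_gf_def once_gf_def by (cases b) (simp_all add: fls_times_fps_to_fls distrib_left mult.assoc)
qed

lemma avoid_gf_2: "avoid_gf True 2 = fls_X"
proof -
  have "alt132_gf True (\<lambda>\<pi>. of_bool (N 2 \<pi> = 0)) = fps_X"
  proof (rule fps_ext)
    fix n
    have "(\<Sum>\<pi>\<in>alt132 n. of_bool (N 2 \<pi> = 0)) = (\<Sum>\<pi>\<in>alt132 n. of_bool (n = 1) :: real)" if "odd n"
      using N_2_odd(1)[OF that] by (intro sum.cong) auto
    then show "fps_nth (alt132_gf True (\<lambda>\<pi>. of_bool (N 2 \<pi> = 0))) n = fps_nth fps_X n"
      by (auto simp: alt132_gf_nth alt132_1)
  qed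
  then show ?thesis by (simp add: avoid_gf_def)
qed

lemma once_gf_2: "once_gf True 2 = fls_X ^ 3"
proof -
  have "alt132_gf True (\<lambda>\<pi>. of_bool (N 2 \<pi> = 1)) = fps_X ^ 3"
  proof (rule fps_ext)
    fix n
    have "(\<Sum>\<pi>\<in>alt132 n. of_bool (N 2 \<pi> = 1)) = (\<Sum>\<pi>\<in>alt132 n. of_bool (n = 3) :: real)" if "odd n"
      using N_2_odd(2)[OF that] by (intro sum.cong) auto
    then show "fps_nth (alt132_gf True (\<lambda>\<pi>. of_bool (N 2 \<pi> = 1))) n = fps_nth (fps_X ^ 3) n"
      by (auto simp: alt132_gf_nth alt132_3)
  qed
  then show ?thesis by (simp add: once_gf_def fps_to_fls_power)
qed

text \<open>Here \<open>k = j + 2\<close>. Nonvanishing is carried along in the induction and later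
  permits division.\<close>

lemma avoid_gf_chebyshev:
  "chebyshev_U_inv2X (Suc j) \<noteq> 0 \<and>
   avoid_gf True (Suc (Suc j)) * chebyshev_U_inv2X (Suc j) = chebyshev_U_inv2X j"
proof (induction j)
  case 0
  have "1 / y \<noteq> 0 \<and> y * (1 / y) = 1" if "y \<noteq> 0" for y :: "real fls" using that by simp
  from this[OF fls_X_nonzero] show ?case
    unfolding chebyshev_U_inv2X_0 chebyshev_U_inv2X_1 numeral_2_eq_2[symmetric] avoid_gf_2 .
next
  case (Suc j)
  let ?x = "fls_X :: real fls" and ?o = "avoid_gf True (Suc (Suc j))" and ?o' = "avoid_gf True (Suc (Suc (Suc j)))"
  let ?V = chebyshev_U_inv2X
  have x: "?x \<noteq> 0" by simp
  have rec: "?o' * (1 - ?x * ?o) = ?x"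
    using mult_one_minus_eqI[OF avoid_gf_rec[of "Suc (Suc (Suc j))" True]] by simp
  then have nz: "1 - ?x * ?o \<noteq> 0" using x by auto
  \<comment> \<open>The three-term recurrence with \<open>?V j\<close> replaced by means of the
    induction hypothesis; it matches the factor in \<open>rec\<close>.\<close>
  have V: "?x * ?V (Suc (Suc j)) = ?V (Suc j) * (1 - ?x * ?o)"
  proof -
    have "y * (v / y - w) = v - y * w" if "y \<noteq> 0" for y v w :: "real fls"
      using that by (simp add: right_diff_distrib)
    then have "?x * ?V (Suc (Suc j)) = ?V (Suc j) - ?x * ?V j"
      using x unfolding chebyshev_U_inv2X_Suc_Suc by blast
    also have "?V j = ?o * ?V (Suc j)" using Suc by simp
    finally show ?thesis by (simp add: algebra_simps)
  qed
  have "?V (Suc (Suc j)) \<noteq> 0" using V nz Suc by auto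
  moreover have "?x * (?o' * ?V (Suc (Suc j))) = ?x * ?V (Suc j)"
  proof -
    have "?x * (?o' * ?V (Suc (Suc j))) = ?o' * (?x * ?V (Suc (Suc j)))" by (simp only: mult.left_commute)
    also have "\<dots> = ?V (Suc j) * (?o' * (1 - ?x * ?o))" unfolding V by (simp only: mult.left_commute)
    finally show ?thesis unfolding rec by (simp only: mult.commute)
  qed
  ultimately show ?case using x by simp
qed

text \<open>The product does not depend on \<open>j\<close>: one step multiplies the series by
  \<open>?o'\<^sup>2\<close>, and \<open>?o'\<close> sends each Chebyshev value to its predecessor.
  The start is \<open>fls_X ^ 3 * (1 / fls_X)\<^sup>2\<close>.\<close>

lemma once_gf_odd: "once_gf True (Suc (Suc j)) * (chebyshev_U_inv2X (Suc j))\<^sup>2 = fls_X"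
proof (induction j)
  case 0
  have "y ^ 3 * (1 / y)\<^sup>2 = y" if "y \<noteq> 0" for y :: "real fls"
    using that by (simp add: field_simps power3_eq_cube power2_eq_square)
  from this[OF fls_X_nonzero] show ?case
    unfolding chebyshev_U_inv2X_1 numeral_2_eq_2[symmetric] once_gf_2 .
next
  case (Suc j)
  let ?x = "fls_X :: real fls" and ?k = "Suc (Suc (Suc j))"
  let ?o = "avoid_gf True (Suc (Suc j))" and ?o' = "avoid_gf True ?k"
  let ?g = "once_gf True (Suc (Suc j))" and ?g' = "once_gf True ?k"
  have rec: "?o' * (1 - ?x * ?o) = ?x"
    using mult_one_minus_eqI[OF avoid_gf_rec[of ?k True]] by simp
  have rec': "?g' * (1 - ?x * ?o) = ?x * ?g * ?o'"
    using mult_one_minus_eqI[OF once_gf_rec[of ?k True]] by simp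
  have "?x * ?g' = ?x * (?g * ?o'\<^sup>2)"
  proof -
    \<comment> \<open>Writing \<open>?x\<close> as \<open>?o' * (1 - ?x * ?o)\<close> avoids
      dividing by \<open>1 - ?x * ?o\<close>.\<close>
    have "?x * ?g' = ?o' * (?g' * (1 - ?x * ?o))" using rec by (simp add: mult.commute mult.left_commute)
    then show ?thesis unfolding rec' by (simp add: power2_eq_square algebra_simps)
  qed
  then have g': "?g' = ?g * ?o'\<^sup>2" by simp
  have "?g' * (chebyshev_U_inv2X (Suc (Suc j)))\<^sup>2 = ?g * (?o' * chebyshev_U_inv2X (Suc (Suc j)))\<^sup>2"
    unfolding g' by (simp only: power_mult_distrib mult.assoc)
  also have "\<dots> = ?x" using Suc avoid_gf_chebyshev[of "Suc j"] by simp
  finally show ?case .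
qed

text \<open>Both parities solve linear equations with the same factor \<open>1 - ?x * ?o\<close>,
  and their right-hand sides differ by a factor \<open>?x\<close>.\<close>

lemma once_gf_even:
  assumes "k \<ge> 3"
  shows "fls_X * once_gf False k = once_gf True k"
proof -
  let ?x = "fls_X :: real fls" and ?o = "avoid_gf True (k - 1)" and ?g = "once_gf True (k - 1)"
  let ?e = "avoid_gf False k"
  have odd: "avoid_gf True k * (1 - ?x * ?o) = ?x"
    using mult_one_minus_eqI[OF avoid_gf_rec[OF assms, of True]] by simp
  have even: "?e * (1 - ?x * ?o) = 1"
    using mult_one_minus_eqI[OF avoid_gf_rec[OF assms, of False]] by simp
  have nz: "1 - ?x * ?o \<noteq> 0" using even by auto
  have "(?x * ?e) * (1 - ?x * ?o) = avoid_gf True k * (1 - ?x * ?o)"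
    using odd even by (simp only: mult.assoc mult_1_right)
  then have xe: "avoid_gf True k = ?x * ?e" using nz by simp
  have "(?x * once_gf False k) * (1 - ?x * ?o) = ?x * (?x * ?g * ?e)"
    using mult_one_minus_eqI[OF once_gf_rec[OF assms, of False]] by (simp only: mult.assoc)
  also have "\<dots> = ?x * ?g * avoid_gf True k" unfolding xe by (simp only: mult_ac)
  also have "\<dots> = once_gf True k * (1 - ?x * ?o)"
    using mult_one_minus_eqI[OF once_gf_rec[OF assms, of True]] by simp
  finally show ?thesis using nz by simp
qed

theorem once_gf_chebyshev:
  assumes "k \<ge> 3"
  shows "once_gf True k = fls_X / (chebyshev_U_inv2X (k - 1))\<^sup>2"
    and "once_gf False k = 1 / (chebyshev_U_inv2X (k - 1))\<^sup>2"
proof -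
  obtain j where k: "k = Suc (Suc j)" using assms that[of "k - 2"] by simp
  have nz: "chebyshev_U_inv2X (k - 1) \<noteq> 0" using avoid_gf_chebyshev[of j] k by simp
  show odd: "once_gf True k = fls_X / (chebyshev_U_inv2X (k - 1))\<^sup>2"
    using once_gf_odd[of j] nz k by (simp add: eq_divide_eq)
  have "fls_X * once_gf False k = fls_X * (1 / (chebyshev_U_inv2X (k - 1))\<^sup>2)"
    using once_gf_even[OF assms] odd by simp
  then show "once_gf False k = 1 / (chebyshev_U_inv2X (k - 1))\<^sup>2"
    by (simp only: mult_left_cancel[OF fls_X_nonzero])
qed

end

subsection \<open>The patterns\<close>

lemma occ_pair_iff:
  "is \<in> occ adj [p, q] \<pi> \<longleftrightarrow> (\<exists>i j. is = [i, j] \<and> i < j \<and> j < length \<pi> \<and>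
     (\<pi> ! i < \<pi> ! j \<longleftrightarrow> p < q) \<and> (\<pi> ! j < \<pi> ! i \<longleftrightarrow> q < p) \<and> (adj \<longrightarrow> j = Suc i))"
proof (cases "length is = 2")
  case True
  then obtain i j where "is = [i, j]" by (auto simp: numeral_2_eq_2 length_Suc_conv)
  then show ?thesis by (auto simp: occ_def less_Suc_eq)
qed (auto simp: occ_def)

lemma two_le_card_occ:
  assumes "u \<in> occ adj t \<pi>" "v \<in> occ adj t \<pi>" "u \<noteq> v"
  shows "2 \<le> card (occ adj t \<pi>)"
proof -
  have "card {u, v} \<le> card (occ adj t \<pi>)"
    using assms by (intro card_mono finite_occ) auto
  then show ?thesis using assms(3) by simp
qed

text \<open>The ascents at indices 0 and 2 are adjacent pairs, so they count for either value of
  \<open>adj\<close>.\<close>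

lemma two_le_card_occ_12:
  assumes "up_alternating \<pi>" "length \<pi> \<ge> 4"
  shows "2 \<le> card (occ adj [1, 2] \<pi>)"
proof (rule two_le_card_occ)
  have "\<pi> ! 0 < \<pi> ! 1" "\<pi> ! 2 < \<pi> ! 3"
    using assms(1)[unfolded up_alternating_def, rule_format, of 0]
      assms(1)[unfolded up_alternating_def, rule_format, of 2] assms(2) by (auto simp: eval_nat_numeral)
  then show "[0, 1] \<in> occ adj [1, 2] \<pi>" "[2, 3] \<in> occ adj [1, 2] \<pi>"
    using assms(2) by (auto simp: occ_pair_iff)
qed simp

lemma two_le_card_occ_21:
  assumes "up_alternating \<pi>" "length \<pi> \<ge> 5"
  shows "2 \<le> card (occ adj [2, 1] \<pi>)"
proof (rule two_le_card_occ)
  have "\<pi> ! 2 < \<pi> ! 1" "\<pi> ! 4 < \<pi> ! 3"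
    using assms(1)[unfolded up_alternating_def, rule_format, of 1]
      assms(1)[unfolded up_alternating_def, rule_format, of 3] assms(2) by (simp_all flip: numeral_2_eq_2)
  then show "[1, 2] \<in> occ adj [2, 1] \<pi>" "[3, 4] \<in> occ adj [2, 1] \<pi>"
    using assms(2) by (auto simp: occ_pair_iff)
qed simp

lemma occ_12_231: "occ adj [1, 2] [2, 3, 1] = {[0, 1]}"
  by (rule set_eqI) (auto simp: occ_pair_iff less_Suc_eq)

lemma occ_21_231: "occ True [2, 1] [2, 3, 1] = {[1, 2]}"
  by (rule set_eqI) (auto simp: occ_pair_iff less_Suc_eq)

text \<open>The point where 2-1 departs from 21: only one of the two inversions of 231 is
  adjacent.\<close>

lemma two_le_card_occ_2_1_231: "2 \<le> card (occ False [2, 1] [2, 3, 1])"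
  by (rule two_le_card_occ[of "[0, 2]" _ _ _ "[1, 2]"]) (auto simp: occ_pair_iff)

lemma prefix_max_statistic_occ:
  assumes "length t = 2" "set t = {1, 2}"
  shows "prefix_max_statistic (\<lambda>k \<pi>. card (occ adj (t @ [3..<Suc k]) \<pi>))"
proof
  fix k i l L R assume k: "k \<ge> (3::nat)" and LR: "L \<in> alt132 i" "R \<in> alt132 l"
  \<comment> \<open>Splits off the largest letter; for \<open>k = 3\<close> the remaining pattern is
    \<open>t\<close> itself.\<close>
  have e: "t @ [3..<Suc k] = (t @ [3..<Suc (k - 1)]) @ [k]"
    using k by simp
  show "card (occ adj (t @ [3..<Suc k]) (glue L R)) = card (occ adj (t @ [3..<Suc k]) L) +
      card (occ adj (t @ [3..<Suc k]) R) + card (occ adj (t @ [3..<Suc (k - 1)]) L)"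
    unfolding e using assms k by (intro card_occ_glue[OF _ _ LR]) auto
next
  fix k :: nat and \<pi> :: "nat list" assume "2 \<le> k" "length \<pi> < 2"
  then have "length \<pi> < length (t @ [3..<Suc k])" using assms by simp
  then show "card (occ adj (t @ [3..<Suc k]) \<pi>) = 0" by (simp only: occ_short card.empty)
qed

lemma single_base_statistic_occ:
  assumes "t = [1, 2] \<or> adj \<and> t = [2, 1]"
  shows "single_base_statistic (\<lambda>k \<pi>. card (occ adj (t @ [3..<Suc k]) \<pi>))"
proof -
  interpret prefix_max_statistic "\<lambda>k \<pi>. card (occ adj (t @ [3..<Suc k]) \<pi>)"
    using assms by (intro prefix_max_statistic_occ) auto
  show ?thesis
  proof
    fix \<pi> assume "\<pi> \<in> alt132 3"
    then show "card (occ adj (t @ [3..<Suc 2]) \<pi>) = 1"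
      using assms occ_12_231[of adj] occ_21_231 by (auto simp: alt132_3)
  next
    fix n \<pi> assume A: "odd n" "n \<ge> 5" "\<pi> \<in> alt132 n"
    then show "2 \<le> card (occ adj (t @ [3..<Suc 2]) \<pi>)"
      using assms two_le_card_occ_12[of \<pi> adj] two_le_card_occ_21[of \<pi> adj]
        alt132D(1)[OF A(3)] alt132D(4)[OF A(3)] by auto
  qed
qed

section \<open>Translation from patterns to statistics and conclusion\<close>

lemma contains_exactly_extend_pattern:
  assumes "\<tau> = [[a, b]] \<or> \<tau> = [[a], [b]]" and "k \<ge> 2"
  shows "contains_exactly r (extend_pattern \<tau> k) \<pi> \<longleftrightarrow>
    card (occ (length \<tau> = 1) (concat \<tau> @ [3..<Suc k]) \<pi>) = r"
  by (simp only: contains_exactly_def occurrences_extend_pattern[OF assms])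

lemma up_down_perms_avoiding:
  "\<pi> \<in> up_down_perms n \<and> avoids [[1], [3], [2]] \<pi> \<longleftrightarrow> n \<ge> 2 \<and> odd n \<and> \<pi> \<in> alt132 n"
  by (auto simp: up_down_perms_def avoids_132_iff[simplified] alt132_def)

lemma up_up_perms_avoiding:
  "\<pi> \<in> up_up_perms n \<and> avoids [[1], [3], [2]] \<pi> \<longleftrightarrow> n \<ge> 2 \<and> even n \<and> \<pi> \<in> alt132 n"
  by (auto simp: up_up_perms_def avoids_132_iff[simplified] alt132_def)

context single_base_statistic
begin

lemma once_gf_eq_ud:
  assumes "k \<ge> 3" and "\<And>\<pi>. contains_exactly 1 p \<pi> \<longleftrightarrow> N k \<pi> = 1"
  shows "fps_to_fls (Abs_fps (\<lambda>n. real (ud p n))) = once_gf True k"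
    and "fps_to_fls (Abs_fps (\<lambda>n. real (uu p n))) = once_gf False k"
proof -
  \<comment> \<open>Lengths 0 and 1, excluded in \<open>ud\<close> and \<open>uu\<close> but present
    in \<open>alt132\<close>, contribute nothing.\<close>
  have long: "n \<ge> 2" if "\<pi> \<in> alt132 n" "N k \<pi> = 1" for n \<pi>
    using N_short[of k \<pi>] alt132D(1)[OF that(1)] that(2) assms(1) by (rule_tac ccontr) simp
  have "{\<pi> \<in> up_down_perms n. avoids [[1],[3],[2]] \<pi> \<and> contains_exactly 1 p \<pi>} =
      (if odd n then alt132 n \<inter> {\<pi>. N k \<pi> = 1} else {})" for n
    using up_down_perms_avoiding[of _ n] long[of _ n] assms(2) by auto
  then have "real (ud p n) = (if odd n then \<Sum>\<pi>\<in>alt132 n. of_bool (N k \<pi> = 1) else 0)" for n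
    by (simp add: ud_def finite_alt132)
  then show "fps_to_fls (Abs_fps (\<lambda>n. real (ud p n))) = once_gf True k"
    by (simp add: once_gf_def alt132_gf_def del: One_nat_def)
  have "{\<pi> \<in> up_up_perms n. avoids [[1],[3],[2]] \<pi> \<and> contains_exactly 1 p \<pi>} =
      (if even n then alt132 n \<inter> {\<pi>. N k \<pi> = 1} else {})" for n
    using up_up_perms_avoiding[of _ n] long[of _ n] assms(2) by auto
  then have "real (uu p n) = (if odd n = False then \<Sum>\<pi>\<in>alt132 n. of_bool (N k \<pi> = 1) else 0)" for n
    by (simp add: uu_def finite_alt132)
  then show "fps_to_fls (Abs_fps (\<lambda>n. real (uu p n))) = once_gf False k"
    by (simp add: once_gf_def alt132_gf_def del: One_nat_def)
qed

end

text \<open>At odd lengths the number of inversions is 0 for length 1 and at least 2 otherwise;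
  \<open>N_neq_1\<close> carries this to all \<open>k \<ge> 3\<close> and to both parities.\<close>

lemma contains_2_1_not_once:
  assumes k: "k \<ge> 3" and \<pi>: "\<pi> \<in> alt132 n"
  shows "\<not> contains_exactly 1 (extend_pattern [[2], [1]] k) \<pi>"
proof -
  interpret prefix_max_statistic "\<lambda>k \<pi>. card (occ False ([2, 1] @ [3..<Suc k]) \<pi>)"
    by (rule prefix_max_statistic_occ) auto
  have "card (occ False ([2, 1] @ [3..<Suc 2]) \<pi>) \<noteq> 1" if "odd n" "\<pi> \<in> alt132 n" for n \<pi>
  proof -
    have "n = 1 \<or> n = 3 \<or> n \<ge> 5" using that(1) by presburger
    then consider "n = 1" | "n = 3" | "n \<ge> 5" by blast
    then show ?thesis
    proof cases
      case 1
      then show ?thesis using occ_short[of \<pi> "[2, 1]" False] alt132D(1)[OF that(2)] by simp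
    next
      case 2
      then show ?thesis using two_le_card_occ_2_1_231 that(2) by (auto simp: alt132_3)
    next
      case 3
      then show ?thesis
        using two_le_card_occ_21[of \<pi> False] alt132D(1,4)[OF that(2)] by auto
    qed
  qed
  from N_neq_1[OF this k \<pi>] show ?thesis
    using contains_exactly_extend_pattern[of "[[2], [1]]" 2 1 k] k by (simp del: upt_Suc)
qed

theorem theorem3p3:
  fixes k :: nat and \<tau> :: gpattern
  assumes "k \<ge> 3"
    and "\<tau> \<in> {[[1,2]], [[2,1]], [[1],[2]]}"
  shows "fps_to_fls (Abs_fps (\<lambda>n. real (ud (extend_pattern \<tau> k) n)))
           = fls_X / (chebyshev_U_inv2X (k - 1))\<^sup>2
       \<and> fps_to_fls (Abs_fps (\<lambda>n. real (uu (extend_pattern \<tau> k) n)))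
           = 1 / (chebyshev_U_inv2X (k - 1))\<^sup>2
       \<and> \<not> (\<exists>n. \<exists>\<pi> \<in> up_down_perms n \<union> up_up_perms n.
           avoids [[1],[3],[2]] \<pi> \<and> contains_exactly 1 (extend_pattern [[2],[1]] k) \<pi>)"
proof -
  \<comment> \<open>The flag is true for the one-block prefixes 12 and 21 and false for 1-2, so one
    instance serves all three.\<close>
  interpret single_base_statistic "\<lambda>k \<pi>. card (occ (length \<tau> = 1) (concat \<tau> @ [3..<Suc k]) \<pi>)"
    using assms(2) by (intro single_base_statistic_occ) auto
  have "contains_exactly 1 (extend_pattern \<tau> k) \<pi> \<longleftrightarrow>
      card (occ (length \<tau> = 1) (concat \<tau> @ [3..<Suc k]) \<pi>) = 1" for \<pi>
    using assms by (intro contains_exactly_extend_pattern[of _ "hd (concat \<tau>)" "last (concat \<tau>)"]) auto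
  note gf = once_gf_eq_ud[OF assms(1) this]
  have "\<not> contains_exactly 1 (extend_pattern [[2],[1]] k) \<pi>"
    if "\<pi> \<in> up_down_perms n \<union> up_up_perms n" "avoids [[1],[3],[2]] \<pi>" for n \<pi>
    using that up_down_perms_avoiding[of \<pi> n] up_up_perms_avoiding[of \<pi> n]
      contains_2_1_not_once[OF assms(1)] by blast
  then show ?thesis
    unfolding gf once_gf_chebyshev[OF assms(1)] by blast
qed

end
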